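(* Let $\mathcal{B}$ be an admissible Banach space of analytic functions on $\mathbb{D}$ (defined in the context), and let $\psi$ be a multiplier of $\mathcal{B}$. Then the multiplication operator $M_\psi:\mathcal{B}\to\mathcal{B}$ is Fredholm if and only if $\psi$ is bounded away from $0$ near $\partial\mathbb{D}$.
   Context: $\mathbb{D}$ is the open unit disk in $\mathbb{C}$, $\mathbb{D}^-$ its closure, $H(\mathbb{D})$ the holomorphic functions on $\mathbb{D}$; $S^-$ denotes the closure of a set $S$. For a Banach space $B\subset H(\mathbb{D})$ with continuous point evaluations, $\psi\in H(\mathbb{D})$ is a multiplier of $B$ if $\psi g\in B$ for all $g\in B$; then $M_\psi:B\to B$, $M_\psi g=\psi g$ (also written $M_{\psi(z)}$; $M_z$ is multiplication by the identity function). An operator is Fredholm if it is bounded and linear with finite-dimensional kernel and closed, finite-codimensional range. A function $\psi\in H(\mathbb{D})$ is bounded away from $0$ near $\partial\mathbb{D}$ if there are $\epsilon>0$ and $0<r<1$ with $|\psi(z)|>\epsilon$ whenever $r<|z|<1$. $C^k(\mathbb{D}^-)$ is the space of functions continuously differentiable on $\mathbb{D}^-$ through order $k$; $B\subset C^k(\mathbb{D}^-)$ means that each $f\in B$ extends to a function (also denoted $f$) in $C^k(\mathbb{D}^-)$. Boundary-extension type: let $B\subset H(\mathbb{D})$ be a Banach space with $M_z:B\to B$ bounded and point evaluations at points of $\mathbb{D}$ continuous. For a positive integer $n$, $B$ has boundary-extension type $n$ if $B\subset C^{n-1}(\mathbb{D}^-)$ and, for each $\zeta\in\partial\mathbb{D}$,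 the closure of the range of $M_{(z-\zeta)^{n+1}}:B\to B$ contains the function $(z-\zeta)^n$. $B$ has boundary-extension type $0$ if, for each $\zeta\in\partial\mathbb{D}$, the closure of the range of $M_{z-\zeta}:B\to B$ contains the constant function $1$. An admissible space is a Banach space $\mathcal{B}$ of analytic functions on $\mathbb{D}$ such that: (i) $\mathcal{B}$ contains the polynomials as a dense subspace; (ii) for each $z\in\mathbb{D}$ the functional $E_z:f\mapsto f(z)$ is continuous on $\mathcal{B}$; (iii) $M_z:\mathcal{B}\to\mathcal{B}$ is bounded and has spectral radius $1$; (iv) if $q$ is a polynomial all of whose zeros lie in $\mathbb{D}$ and $qf\in\mathcal{B}$ for some $f\in H(\mathbb{D})$, then $f\in\mathcal{B}$; (v) if $g$ is a multiplier of $\mathcal{B}$ that is bounded away from $0$ on $\mathbb{D}$, then $1/g$ is a multiplier of $\mathcal{B}$; (vi) for each positive integer $l$, if $q_k(z)=\sum_{j=0}^l a_{j,k}z^j$ are polynomials with $a_{j,k}\to0$ as $k\to\infty$ for each $j\in\{0,\dots,l\}$, then $q_k\to0$ in $\mathcal{B}$; (vii) $\mathcal{B}$ has boundary-extension type $n$ for some nonnegative integer $n$. *)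

theory Defs
  imports
    "HOL-Complex_Analysis.Complex_Analysis"
    "HOL-Library.Function_Algebras"
begin

text \<open>A function on the open unit disk is represented by a total function that vanishes off
  \<open>ball 0 1\<close>, so that equality of representatives is equality on the disk.\<close>

definition on_disk :: "(complex \<Rightarrow> complex) \<Rightarrow> complex \<Rightarrow> complex" where
  "on_disk f = (\<lambda>z. if z \<in> ball 0 1 then f z else 0)"

definition hol_disk :: "(complex \<Rightarrow> complex) set" where
  "hol_disk = {f. f holomorphic_on ball 0 1 \<and> (\<forall>z. z \<notin> ball 0 1 \<longrightarrow> f z = 0)}"

definition cscale :: "complex \<Rightarrow> (complex \<Rightarrow> complex) \<Rightarrow> complex \<Rightarrow> complex" where
  "cscale c f = (\<lambda>z. c * f z)"

global_interpretation cfun: vector_space cscale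
  by unfold_locales (auto simp: cscale_def fun_eq_iff algebra_simps)

text \<open>\<open>mult_op \<psi>\<close> is only applied to functions vanishing off the disk, so the values of \<open>\<psi>\<close> off
  the disk are irrelevant.\<close>

definition mult_op :: "(complex \<Rightarrow> complex) \<Rightarrow> (complex \<Rightarrow> complex) \<Rightarrow> complex \<Rightarrow> complex" where
  "mult_op \<psi> g = (\<lambda>z. \<psi> z * g z)"

definition multiplier :: "(complex \<Rightarrow> complex) set \<Rightarrow> (complex \<Rightarrow> complex) \<Rightarrow> bool" where
  "multiplier B \<psi> \<longleftrightarrow> \<psi> holomorphic_on ball 0 1 \<and> (\<forall>g\<in>B. mult_op \<psi> g \<in> B)"

definition bounded_away_from_0 :: "(complex \<Rightarrow> complex) \<Rightarrow> bool" where
  "bounded_away_from_0 \<psi> \<longleftrightarrow> (\<exists>\<epsilon>>0. \<forall>z\<in>ball 0 1. cmod (\<psi> z) > \<epsilon>)"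

definition bounded_away_from_0_near_boundary :: "(complex \<Rightarrow> complex) \<Rightarrow> bool" where
  "bounded_away_from_0_near_boundary \<psi> \<longleftrightarrow>
     (\<exists>\<epsilon>>0. \<exists>r. 0 < r \<and> r < 1 \<and> (\<forall>z. r < cmod z \<and> cmod z < 1 \<longrightarrow> cmod (\<psi> z) > \<epsilon>))"

text \<open>\<open>C\<^sup>k\<close> on the closed unit disk, for complex-valued functions of two real variables: \<open>gx\<close> and
  \<open>gy\<close> are the two partial derivatives, with derivatives at boundary points taken within the closed
  disk. Only the values of \<open>g\<close> on the closed disk matter.\<close>

fun Ck_closed_disk :: "nat \<Rightarrow> (complex \<Rightarrow> complex) \<Rightarrow> bool" where
  "Ck_closed_disk 0 g \<longleftrightarrow> continuous_on (cball 0 1) g"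
| "Ck_closed_disk (Suc k) g \<longleftrightarrow>
     (\<exists>gx gy. Ck_closed_disk k gx \<and> Ck_closed_disk k gy \<and>
        (\<forall>z\<in>cball 0 1.
          (g has_derivative (\<lambda>h. Re h *\<^sub>R gx z + Im h *\<^sub>R gy z)) (at z within cball 0 1)))"

definition extends_Ck :: "nat \<Rightarrow> (complex \<Rightarrow> complex) \<Rightarrow> bool" where
  "extends_Ck k f \<longleftrightarrow> (\<exists>g. Ck_closed_disk k g \<and> (\<forall>z\<in>ball 0 1. g z = f z))"

locale normed_function_space =
  fixes B :: "(complex \<Rightarrow> complex) set" and nm :: "(complex \<Rightarrow> complex) \<Rightarrow> real"
  assumes subspace_B: "cfun.subspace B"
    and nm_nonneg: "f \<in> B \<Longrightarrow> 0 \<le> nm f"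
    and nm_eq_0_iff: "f \<in> B \<Longrightarrow> nm f = 0 \<longleftrightarrow> f = 0"
    and nm_triangle: "f \<in> B \<Longrightarrow> g \<in> B \<Longrightarrow> nm (f + g) \<le> nm f + nm g"
    and nm_cscale: "f \<in> B \<Longrightarrow> nm (cscale c f) = cmod c * nm f"
begin

text \<open>The library's \<open>Metric_space\<close> wants a distance that is nonnegative and symmetric on the whole
  type, whereas \<open>nm\<close> is arbitrary off \<open>B\<close>.\<close>

definition ndist :: "(complex \<Rightarrow> complex) \<Rightarrow> (complex \<Rightarrow> complex) \<Rightarrow> real" where
  "ndist f g = (if f \<in> B \<and> g \<in> B then nm (f - g) else 0)"

sublocale Metric_space B ndist
proof
  have diff: "f - g \<in> B" if "f \<in> B" "g \<in> B" for f g
    using cfun.subspace_diff[OF subspace_B that] .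
  show "0 \<le> ndist f g" for f g
    by (auto simp: ndist_def intro: nm_nonneg diff)
  show "ndist f g = ndist g f" for f g
  proof (cases "f \<in> B \<and> g \<in> B")
    case True
    have "cscale (- 1) (f - g) = g - f"
      by (auto simp: cscale_def)
    with True show ?thesis
      using nm_cscale[of "f - g" "- 1"] diff[of f g] by (simp add: ndist_def)
  qed (auto simp: ndist_def)
  show "ndist f g = 0 \<longleftrightarrow> f = g" if "f \<in> B" "g \<in> B" for f g
    using that nm_eq_0_iff[OF diff[OF that]] by (simp add: ndist_def)
  show "ndist f h \<le> ndist f g + ndist g h" if "f \<in> B" "g \<in> B" "h \<in> B" for f g h
    using that nm_triangle[OF diff[of f g] diff[of g h]] by (simp add: ndist_def)
qed

definition bounded_operator :: "((complex \<Rightarrow> complex) \<Rightarrow> complex \<Rightarrow> complex) \<Rightarrow> bool" where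
  "bounded_operator T \<longleftrightarrow>
     (\<forall>f\<in>B. T f \<in> B) \<and>
     (\<forall>f\<in>B. \<forall>g\<in>B. T (f + g) = T f + T g) \<and>
     (\<forall>c. \<forall>f\<in>B. T (cscale c f) = cscale c (T f)) \<and>
     (\<exists>C. \<forall>f\<in>B. nm (T f) \<le> C * nm f)"

definition invertible_operator :: "((complex \<Rightarrow> complex) \<Rightarrow> complex \<Rightarrow> complex) \<Rightarrow> bool" where
  "invertible_operator T \<longleftrightarrow>
     bounded_operator T \<and> (\<exists>S. bounded_operator S \<and> (\<forall>f\<in>B. S (T f) = f \<and> T (S f) = f))"

definition spectrum :: "((complex \<Rightarrow> complex) \<Rightarrow> complex \<Rightarrow> complex) \<Rightarrow> complex set" where
  "spectrum T = {c. \<not> invertible_operator (\<lambda>f. T f - cscale c f)}"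

text \<open>The supremum is taken in \<open>ereal\<close>, where it exists without a boundedness proof.\<close>

definition spectral_radius :: "((complex \<Rightarrow> complex) \<Rightarrow> complex \<Rightarrow> complex) \<Rightarrow> ereal" where
  "spectral_radius T = (SUP c\<in>spectrum T. ereal (cmod c))"

definition fredholm :: "((complex \<Rightarrow> complex) \<Rightarrow> complex \<Rightarrow> complex) \<Rightarrow> bool" where
  "fredholm T \<longleftrightarrow>
     bounded_operator T \<and>
     (\<exists>F. finite F \<and> cfun.span F = {f \<in> B. T f = 0}) \<and>
     closedin mtopology (T ` B) \<and>
     (\<exists>F. finite F \<and> cfun.span (T ` B \<union> F) = B)"

end

locale disk_banach_space = normed_function_space +
  assumes holomorphic: "B \<subseteq> hol_disk"
    and mcomplete_B: "mcomplete"
    and point_evaluation: "z \<in> ball 0 1 \<Longrightarrow> continuous_map mtopology euclidean (\<lambda>f. f z)"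
    and bounded_Mz: "bounded_operator (mult_op (\<lambda>z. z))"
begin

definition boundary_extension_type :: "nat \<Rightarrow> bool" where
  "boundary_extension_type n \<longleftrightarrow>
     (n > 0 \<longrightarrow> (\<forall>f\<in>B. extends_Ck (n - 1) f)) \<and>
     (\<forall>\<zeta>\<in>sphere 0 1.
        on_disk (\<lambda>z. (z - \<zeta>) ^ n) \<in> mtopology closure_of (mult_op (\<lambda>z. (z - \<zeta>) ^ (n + 1)) ` B))"

end

text \<open>In \<open>division\<close> the zero polynomial is excluded automatically, since all of its zeros would
  have to lie in the disk.\<close>

locale admissible_space = disk_banach_space +
  assumes polynomials_subset: "range (\<lambda>p. on_disk (poly p)) \<subseteq> B"
    and polynomials_dense: "mtopology closure_of (range (\<lambda>p. on_disk (poly p))) = B"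
    and spectral_radius_Mz: "spectral_radius (mult_op (\<lambda>z. z)) = 1"
    and division: "(\<And>z. poly q z = 0 \<Longrightarrow> z \<in> ball 0 1) \<Longrightarrow> f \<in> hol_disk \<Longrightarrow>
       mult_op (poly q) f \<in> B \<Longrightarrow> f \<in> B"
    and inverse_multiplier: "multiplier B g \<Longrightarrow> bounded_away_from_0 g \<Longrightarrow>
       multiplier B (\<lambda>z. 1 / g z)"
    and coefficientwise_limit: "l > 0 \<Longrightarrow> (\<And>j. j \<le> l \<Longrightarrow> (\<lambda>k. a j k) \<longlonglongrightarrow> 0) \<Longrightarrow>
       limitin mtopology (\<lambda>k::nat. on_disk (\<lambda>z. \<Sum>j\<le>l. a j k * z ^ j)) 0 sequentially"
    and boundary_extension: "\<exists>n. boundary_extension_type n"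

end

theory Submission
  imports Defs "HOL-Computational_Algebra.Fundamental_Theorem_Algebra"
begin

text \<open>
  The closed graph theorem makes every multiplier a bounded operator, and makes an injective bounded
  operator with closed range map closed sets to closed sets.

  If \<open>\<psi>\<close> is bounded away from \<open>0\<close> near the boundary, then \<open>\<psi> = q g\<close> with \<open>q\<close> a polynomial having all
  its zeros in the disk and \<open>g\<close> an invertible multiplier. So \<open>\<psi> B = q B\<close>, which is handled one linear
  factor at a time: \<open>(z - a) B\<close> is the kernel of the evaluation at \<open>a\<close>.

  Conversely, let \<open>M\<^sub>\<psi>\<close> be Fredholm. As \<open>\<psi> B\<close> has finite codimension, it contains a polynomial
  \<open>p \<noteq> 0\<close>; again \<open>\<psi> = q g\<close> with \<open>g\<close> zero-free, \<open>g B\<close> is closed and \<open>p B \<subseteq> g B\<close>. Hence \<open>p\<^sup>k \<in> g\<^sup>k B\<close> for all \<open>k\<close>.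
  If \<open>n\<close> is the boundary-extension type, the exponent of any linear factor of an element of the closed
  submodule \<open>g\<^sup>k B\<close> can be lowered as long as it exceeds \<open>n\<close>; so \<open>p\<^sup>n \<in> g\<^sup>k B\<close> for every \<open>k\<close>, and the
  codimension of \<open>g\<^sup>k B\<close> is at most \<open>d = degree (p\<^sup>n)\<close>, independently of \<open>k\<close>. With \<open>k = d + 1\<close> the functions
  \<open>1, g, \<dots>, g\<^sup>d\<close> are dependent modulo \<open>g\<^sup>k B\<close>, which forces \<open>1 \<in> g B\<close>. Therefore \<open>g B = B\<close>, \<open>1 / g\<close> is a
  multiplier, and multipliers are bounded functions.
\<close>

section \<open>The closed graph theorem\<close>

context normed_function_space
begin

section \<open>Norm arithmetic in \<open>B\<close>; convergence, closedness and completeness by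
  sequences\<close>

lemma B_0: "0 \<in> B" and B_add: "f \<in> B \<Longrightarrow> g \<in> B \<Longrightarrow> f + g \<in> B"
  and B_diff: "f \<in> B \<Longrightarrow> g \<in> B \<Longrightarrow> f - g \<in> B" and B_scale: "f \<in> B \<Longrightarrow> cscale c f \<in> B"
  using subspace_B cfun.subspace_0 cfun.subspace_add cfun.subspace_diff cfun.subspace_scale by blast+

lemma nm_0: "nm 0 = 0"
  using nm_eq_0_iff[OF B_0] by simp

lemma nm_diff_commute:
  assumes "f \<in> B" "g \<in> B"
  shows "nm (f - g) = nm (g - f)"
proof -
  have "cscale (- 1) (f - g) = g - f"
    by (auto simp: cscale_def)
  with nm_cscale[OF B_diff[OF assms], of "- 1"] show ?thesis by simp
qed

lemma nm_triangle_diff: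
  assumes "f \<in> B" "g \<in> B" "h \<in> B"
  shows "nm (f - h) \<le> nm (f - g) + nm (g - h)"
  using nm_triangle[OF B_diff[OF assms(1,2)] B_diff[OF assms(2,3)]] by simp

lemma nm_diff_le:
  assumes "f \<in> B" "g \<in> B"
  shows "nm (f - g) \<le> nm f + nm g"
  using nm_triangle_diff[OF assms(1) B_0 assms(2)] nm_diff_commute[OF B_0 assms(2)] by simp

lemma nm_le_diff:
  assumes "f \<in> B" "g \<in> B"
  shows "nm f \<le> nm g + nm (f - g)"
  using nm_triangle[OF assms(2) B_diff[OF assms]] by simp

lemma limitin_iff_nm:
  assumes "\<And>n. s n \<in> B" "x \<in> B"
  shows "limitin mtopology s x sequentially \<longleftrightarrow> (\<lambda>n. nm (s n - x)) \<longlonglongrightarrow> 0"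
proof -
  have "\<bar>nm (s n - x)\<bar> = ndist (s n) x" for n
    using assms nm_nonneg[OF B_diff[OF assms]] by (simp add: ndist_def)
  then show ?thesis
    using assms by (simp add: limit_metric_sequentially lim_sequentially dist_real_def)
qed

text \<open>The topology is metric, so closed sets are the sequentially closed ones. Later
  closedness proofs thereby deal only with real sequences of norms, free of the case distinction in
  \<open>ndist\<close>.\<close>

lemma closedin_iff_nm:
  "closedin mtopology S \<longleftrightarrow> S \<subseteq> B \<and>
     (\<forall>s x. (\<forall>n. s n \<in> S) \<longrightarrow> x \<in> B \<longrightarrow> (\<lambda>n. nm (s n - x)) \<longlonglongrightarrow> 0 \<longrightarrow> x \<in> S)"
    (is "?L \<longleftrightarrow> ?R")
proof
  assume L: ?L
  then have *: "S \<subseteq> B" "\<And>\<sigma> l. range \<sigma> \<subseteq> S \<Longrightarrow> limitin mtopology \<sigma> l sequentially \<Longrightarrow> l \<in> S"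
    by (auto simp: metric_closedin_iff_sequentially_closed)
  show ?R
  proof (intro conjI allI impI)
    fix s x assume a: "\<forall>n. s n \<in> S" "x \<in> B" "(\<lambda>n. nm (s n - x)) \<longlonglongrightarrow> 0"
    with *(1) have "limitin mtopology s x sequentially"
      by (subst limitin_iff_nm) auto
    with a show "x \<in> S" by (intro *(2)[of s]) auto
  qed (fact *)
next
  assume R: ?R
  show ?L
    unfolding metric_closedin_iff_sequentially_closed
  proof (intro conjI allI impI)
    fix s x assume a: "range s \<subseteq> S \<and> limitin mtopology s x sequentially"
    then have x: "x \<in> B" and s: "\<And>n. s n \<in> S" by (auto dest: limitin_mspace)
    with R have "\<And>n. s n \<in> B" by auto
    with a x have "(\<lambda>n. nm (s n - x)) \<longlonglongrightarrow> 0"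
      by (simp add: limitin_iff_nm)
    with R x s show "x \<in> S" by blast
  qed (use R in blast)
qed

lemma closedinD_nm:
  assumes "closedin mtopology S" "\<And>n. s n \<in> S" "x \<in> B" "(\<lambda>n. nm (s n - x)) \<longlonglongrightarrow> 0"
  shows "x \<in> S"
proof -
  have "\<forall>s x. (\<forall>n. s n \<in> S) \<longrightarrow> x \<in> B \<longrightarrow> (\<lambda>n. nm (s n - x)) \<longlonglongrightarrow> 0 \<longrightarrow> x \<in> S"
    using assms(1) by (simp add: closedin_iff_nm)
  from this[THEN spec[of _ s], THEN spec[of _ x]] assms(2-) show ?thesis by simp
qed

lemma mcompleteD_nm:
  assumes mcomplete and s: "\<And>n. s n \<in> B"
    and cauchy: "\<And>e. e > 0 \<Longrightarrow> \<exists>N. \<forall>m\<ge>N. \<forall>n\<ge>N. nm (s m - s n) < e"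
  shows "\<exists>x\<in>B. (\<lambda>n. nm (s n - x)) \<longlonglongrightarrow> 0"
proof -
  have "MCauchy s"
    unfolding MCauchy_def using s cauchy by (auto simp: ndist_def)
  with \<open>mcomplete\<close> obtain x where x: "limitin mtopology s x sequentially"
    by (auto simp: mcomplete_def)
  then have "x \<in> B" by (rule limitin_mspace)
  with x s show ?thesis
    by (auto simp: limitin_iff_nm)
qed

lemma mcomplete_if_nm:
  assumes "\<And>s. (\<And>n. s n \<in> B) \<Longrightarrow> (\<And>e. e > 0 \<Longrightarrow> \<exists>N. \<forall>m\<ge>N. \<forall>n\<ge>N. nm (s m - s n) < e)
     \<Longrightarrow> \<exists>x\<in>B. (\<lambda>n. nm (s n - x)) \<longlonglongrightarrow> 0"
  shows mcomplete
  unfolding mcomplete_def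
proof (intro allI impI)
  fix s assume s: "MCauchy s"
  then have sB: "s n \<in> B" for n by (auto simp: MCauchy_def)
  have "\<exists>N. \<forall>m\<ge>N. \<forall>n\<ge>N. nm (s m - s n) < e" if "e > 0" for e
    using s that sB unfolding MCauchy_def by (simp add: ndist_def)
  from assms[OF sB this] obtain x where "x \<in> B" "(\<lambda>n. nm (s n - x)) \<longlonglongrightarrow> 0" by blast
  with sB show "\<exists>x. limitin mtopology s x sequentially"
    using limitin_iff_nm by blast
qed

text \<open>By Baire, some closure of \<open>{f. ny (S f) \<le> n}\<close> contains a ball; translating that ball to the
  origin and rescaling gives the estimate.\<close>

lemma Baire_approximation:
  assumes mcomplete and Y: "normed_function_space C ny"
    and SC: "\<And>f. f \<in> B \<Longrightarrow> S f \<in> C"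
    and diff: "\<And>f g. f \<in> B \<Longrightarrow> g \<in> B \<Longrightarrow> S (f - g) = S f - S g"
    and scale: "\<And>f c. f \<in> B \<Longrightarrow> S (cscale c f) = cscale c (S f)"
  shows "\<exists>K\<ge>0. \<forall>f\<in>B. \<forall>e>0. \<exists>u\<in>B. ny (S u) \<le> K * nm f \<and> nm (f - u) < e"
proof -
  interpret Y: normed_function_space C ny by fact
  define A where "A n = mtopology closure_of {f\<in>B. ny (S f) \<le> real n}" for n
  have "\<Union>(range A) = B"
  proof
    show "\<Union>(range A) \<subseteq> B"
      using closure_of_subset_topspace[of mtopology] by (auto simp: A_def)
    show "B \<subseteq> \<Union>(range A)"
    proof
      fix f assume f: "f \<in> B"
      obtain n where "ny (S f) \<le> real n" using real_arch_simple by blast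
      moreover have "{f\<in>B. ny (S f) \<le> real n} \<subseteq> A n"
        unfolding A_def by (rule closure_of_subset) auto
      ultimately show "f \<in> \<Union>(range A)" using f by blast
    qed
  qed
  moreover have "mtopology interior_of B \<noteq> {}"
    using interior_of_topspace[of mtopology] B_0 by auto
  moreover have "closedin mtopology (A n)" for n
    by (simp add: A_def)
  ultimately have "\<exists>n. mtopology interior_of A n \<noteq> {}"
    using metric_Baire_category_alt[OF \<open>mcomplete\<close>, of "range A"] by fastforce
  then obtain n x r where x: "x \<in> B" and r: "r > 0" and sub: "mball x r \<subseteq> A n"
    by (auto simp: metric_interior_of)
  have approx: "\<exists>u\<in>B. ny (S u) \<le> real n \<and> nm (f - u) < e" if "f \<in> A n" "e > 0" for f e
  proof -
    from that have "f \<in> B" "\<exists>y\<in>{f\<in>B. ny (S f) \<le> real n}. y \<in> mball f e"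
      unfolding A_def metric_closure_of by blast+
    then show ?thesis by (auto simp: ndist_def)
  qed
  have small: "\<exists>w\<in>B. ny (S w) \<le> 2 * real n \<and> nm (f - w) < e"
    if f: "f \<in> B" "nm f < r" and e: "e > 0" for f e
  proof -
    have "nm (x - (x + f)) = nm f"
      using nm_diff_commute[of x "x + f"] x f B_add by simp
    then have "x \<in> mball x r" "x + f \<in> mball x r"
      using x f r nm_0 B_add by (simp_all add: ndist_def)
    then have "x \<in> A n" "x + f \<in> A n"
      using sub by blast+
    then obtain u v where u: "u \<in> B" "ny (S u) \<le> real n" "nm (x + f - u) < e/2"
      and v: "v \<in> B" "ny (S v) \<le> real n" "nm (x - v) < e/2"
      using approx e by (meson half_gt_zero)
    have "ny (S (u - v)) \<le> 2 * real n"
      using Y.nm_diff_le[OF SC[OF u(1)] SC[OF v(1)]] u v diff by simp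
    moreover have "nm (f - (u - v)) < e"
    proof -
      have "nm ((x + f - u) - (x - v)) \<le> nm (x + f - u) + nm (x - v)"
        by (intro nm_diff_le B_diff B_add x f u v)
      with u v show ?thesis by (simp add: algebra_simps)
    qed
    ultimately show ?thesis using B_diff[OF u(1) v(1)] by blast
  qed
  have "\<exists>u\<in>B. ny (S u) \<le> 4 * n / r * nm f \<and> nm (f - u) < e" if f: "f \<in> B" and e: "e > 0" for f e
  proof (cases "f = 0")
    case True
    have "S 0 = 0" using diff[OF B_0 B_0] by simp
    with True B_0 e show ?thesis using nm_0 Y.nm_0 by (intro bexI[of _ 0]) auto
  next
    case False
    with f nm_nonneg[of f] nm_eq_0_iff[of f] have pos: "nm f > 0" by force
    \<comment> \<open>This factor brings the norm of \<open>f\<close> down to \<open>r / 2\<close>,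
      inside the ball where \<open>small\<close> applies. The tolerance is scaled along, so that
      undoing the scaling leaves an error below \<open>e\<close>.\<close>
    define a where "a = r / (2 * nm f)"
    have a: "a > 0" using r pos by (simp add: a_def)
    have cc: "cscale (complex_of_real (1/a)) (cscale a g) = g" for g
      using a by (auto simp: cscale_def)
    have "nm (cscale a f) < r"
    proof -
      have "nm (cscale a f) = a * nm f" using nm_cscale[OF f, of a] a by simp
      also have "\<dots> = r / 2" using pos by (simp add: a_def)
      finally show ?thesis using r by simp
    qed
    then obtain w where w: "w \<in> B" "ny (S w) \<le> 2 * real n" "nm (cscale a f - w) < a * e"
      using small[of "cscale a f" "a * e"] B_scale[OF f] a e by auto
    let ?u = "cscale (1/a) w"
    have "f - ?u = cscale (1/a) (cscale a f - w)"
      using a by (auto simp: cscale_def fun_eq_iff algebra_simps)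
    then have "nm (f - ?u) = nm (cscale a f - w) / a"
      using nm_cscale[OF B_diff[OF B_scale[OF f] w(1)]] a by (simp add: norm_divide)
    also have "\<dots> < e" using w a by (simp add: field_simps)
    finally have 1: "nm (f - ?u) < e" .
    have "ny (S ?u) = ny (S w) / a"
      using scale[OF w(1)] Y.nm_cscale[OF SC[OF w(1)]] a by (simp add: norm_divide)
    also have "\<dots> \<le> 2 * n / a" using w a by (intro divide_right_mono) auto
    also have "\<dots> = 4 * n / r * nm f" using r pos by (simp add: a_def)
    finally show ?thesis using 1 B_scale[OF w(1)] by blast
  qed
  then show ?thesis using r by (intro exI[of _ "4 * n / r"]) auto
qed

text \<open>Successive approximation: each correction is controlled through
  \<open>Baire_approximation\<close> and halves the remainder. The images of the partial sums form a
  Cauchy sequence in \<open>C\<close>, and the closed graph identifies its limit with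
  \<open>S f\<close>. The target is a second space, so that the theorem also applies to an inverse
  defined only on the range of an operator.\<close>

theorem closed_graph:
  assumes mcomplete and Y: "normed_function_space C ny"
    and Yc: "Metric_space.mcomplete C (normed_function_space.ndist C ny)"
    and SC: "\<And>f. f \<in> B \<Longrightarrow> S f \<in> C"
    and add: "\<And>f g. f \<in> B \<Longrightarrow> g \<in> B \<Longrightarrow> S (f + g) = S f + S g"
    and scale: "\<And>f c. f \<in> B \<Longrightarrow> S (cscale c f) = cscale c (S f)"
    and closed: "\<And>s f h. (\<And>n. s n \<in> B) \<Longrightarrow> f \<in> B \<Longrightarrow> h \<in> C \<Longrightarrow> (\<lambda>n. nm (s n - f)) \<longlonglongrightarrow> 0 \<Longrightarrow>
        (\<lambda>n. ny (S (s n) - h)) \<longlonglongrightarrow> 0 \<Longrightarrow> S f = h"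
  shows "\<exists>K. \<forall>f\<in>B. ny (S f) \<le> K * nm f"
proof -
  interpret Y: normed_function_space C ny by fact
  have diff: "S (f - g) = S f - S g" if "f \<in> B" "g \<in> B" for f g
    using add[OF B_diff[OF that] that(2)] by simp
  from Baire_approximation[OF \<open>mcomplete\<close> Y SC diff scale] obtain K where K: "K \<ge> 0" and
    approx: "\<And>f e. f \<in> B \<Longrightarrow> e > 0 \<Longrightarrow> \<exists>u\<in>B. ny (S u) \<le> K * nm f \<and> nm (f - u) < e"
    by blast
  have S0: "S 0 = 0" using diff[OF B_0 B_0] by simp
  \<comment> \<open>The tolerance is \<open>nm f / 2\<close>, which is positive only for nonzero
    \<open>f\<close>; for \<open>f = 0\<close> the choice \<open>u = 0\<close> serves.\<close>
  have "\<exists>u\<in>B. ny (S u) \<le> K * nm f \<and> nm (f - u) \<le> nm f / 2" if f: "f \<in> B" for f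
  proof (cases "nm f = 0")
    case True
    then have "f = 0" using nm_eq_0_iff f by simp
    then show ?thesis using B_0 S0 nm_0 Y.nm_0 by (intro bexI[of _ 0]) auto
  next
    case False
    with nm_nonneg[OF f] have "nm f / 2 > 0" by simp
    from approx[OF f this] show ?thesis by (meson less_imp_le)
  qed
  then obtain U where U: "\<And>f. f \<in> B \<Longrightarrow> U f \<in> B" "\<And>f. f \<in> B \<Longrightarrow> ny (S (U f)) \<le> K * nm f"
    "\<And>f. f \<in> B \<Longrightarrow> nm (f - U f) \<le> nm f / 2"
    by metis
  have "ny (S f) \<le> 2 * K * nm f" if f: "f \<in> B" for f
  proof -
    \<comment> \<open>\<open>F k\<close> is the remainder after \<open>k\<close> corrections, and
      \<open>s k\<close> below is the sum of those corrections.\<close>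
    define F where "F k = ((\<lambda>g. g - U g) ^^ k) f" for k
    have F0: "F 0 = f" and F_Suc: "F (Suc k) = F k - U (F k)" for k
      by (simp_all add: F_def)
    have FB: "F k \<in> B" for k
      by (induction k) (simp add: F0 f, unfold F_Suc, rule B_diff, auto intro: U)
    have nF: "nm (F k) \<le> nm f / 2 ^ k" for k
    proof (induction k)
      case (Suc k)
      have "nm (F (Suc k)) \<le> nm (F k) / 2" using U(3)[OF FB] by (simp add: F_Suc)
      also have "\<dots> \<le> nm f / 2 ^ Suc k" using Suc by simp
      finally show ?case .
    qed (simp add: F0)
    define s where "s k = f - F k" for k
    have sB: "s k \<in> B" for k by (simp add: s_def B_diff f FB)
    define c where "c = K * nm f"
    have c: "c \<ge> 0" using K nm_nonneg[OF f] by (simp add: c_def)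
    have S_Suc: "S (s (Suc k)) = S (s k) + S (U (F k))" for k
    proof -
      have "s (Suc k) = s k + U (F k)" by (simp add: s_def F_Suc)
      with add[OF sB[of k] U(1)[OF FB[of k]]] show ?thesis by simp
    qed
    \<comment> \<open>The right-hand side is the closed form of the sum of \<open>c / 2 ^ i\<close>
      over \<open>k \<le> i < k + j\<close>, which lets the induction telescope.\<close>
    have step: "ny (S (s (k + j)) - S (s k)) \<le> 2 * c / 2 ^ k - 2 * c / 2 ^ (k + j)" for k j
    proof (induction j)
      case (Suc j)
      have "ny (S (s (k + Suc j)) - S (s k)) \<le> ny (S (s (k + j)) - S (s k)) + ny (S (U (F (k + j))))"
        using Y.nm_triangle[OF Y.B_diff[OF SC[OF sB[of "k + j"]] SC[OF sB[of k]]]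
            SC[OF U(1)[OF FB[of "k + j"]]]] by (simp add: S_Suc algebra_simps)
      also have "ny (S (U (F (k + j)))) \<le> K * (nm f / 2 ^ (k + j))"
        using U(2)[OF FB] nF K by (meson mult_left_mono order_trans)
      also have "\<dots> = 2 * c / 2 ^ (k + j) - 2 * c / 2 ^ (k + Suc j)" by (simp add: c_def)
      finally show ?case using Suc by simp
    qed (use Y.nm_0 in \<open>simp add: zero_fun_def\<close>)
    have bound: "ny (S (s j) - S (s k)) \<le> 2 * c / 2 ^ k" if "k \<le> j" for j k
    proof -
      have "ny (S (s j) - S (s k)) \<le> 2 * c / 2 ^ k - 2 * c / 2 ^ j"
        using step[of k "j - k"] that by simp
      then show ?thesis using c by (smt (verit) divide_nonneg_nonneg zero_le_power)
    qed
    have null: "(\<lambda>k. a / 2 ^ k) \<longlonglongrightarrow> 0" for a :: real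
      using tendsto_mult[OF tendsto_const LIMSEQ_realpow_zero[of "1/2"], of a]
      by (simp add: power_divide)
    have "\<exists>N. \<forall>m\<ge>N. \<forall>n\<ge>N. ny (S (s m) - S (s n)) < e" if "e > 0" for e
    proof -
      have "\<forall>\<^sub>F N in sequentially. 2 * c / 2 ^ N < e / 2"
        using order_tendstoD(2)[OF null] that by simp
      then obtain N where N: "2 * c / 2 ^ N < e / 2"
        unfolding eventually_sequentially by blast
      have "ny (S (s m) - S (s n)) < e" if "m \<ge> N" "n \<ge> N" for m n
        using Y.nm_triangle_diff[OF SC[OF sB[of m]] SC[OF sB[of N]] SC[OF sB[of n]]]
          Y.nm_diff_commute[OF SC[OF sB[of N]] SC[OF sB[of n]]] bound[OF that(1)] bound[OF that(2)] N
        by linarith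
      then show ?thesis by blast
    qed
    then obtain h where h: "h \<in> C" "(\<lambda>n. ny (S (s n) - h)) \<longlonglongrightarrow> 0"
      using Y.mcompleteD_nm[OF Yc, of "\<lambda>n. S (s n)"] SC sB by blast
    have "(\<lambda>n. nm (s n - f)) \<longlonglongrightarrow> 0"
    proof (rule tendsto_sandwich[OF _ _ tendsto_const null[of "nm f"]])
      have "nm (s n - f) = nm (F n)" for n
        using nm_diff_commute[OF sB f] by (simp add: s_def)
      then show "\<forall>\<^sub>F n in sequentially. nm (s n - f) \<le> nm f / 2 ^ n" using nF by simp
      show "\<forall>\<^sub>F n in sequentially. 0 \<le> nm (s n - f)" by (simp add: nm_nonneg B_diff sB f)
    qed
    from closed[OF sB f h(1) this h(2)] have Sf: "S f = h" .
    \<comment> \<open>Because \<open>s 0 = 0\<close>, the Cauchy estimate started at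
      \<open>0\<close> bounds every partial image by \<open>2 * c\<close>, and the bound passes to
      the limit.\<close>
    have "ny (S f) \<le> 2 * c + ny (S (s n) - h)" for n
    proof -
      have "s 0 = 0" by (simp add: s_def F0)
      then have "ny (S (s n)) \<le> 2 * c" using bound[of 0 n] S0 by simp
      then show ?thesis
        using Y.nm_le_diff[OF h(1) SC[OF sB[of n]]] Y.nm_diff_commute[OF h(1) SC[OF sB[of n]]] Sf by simp
    qed
    then have "ny (S f) \<le> 2 * c + 0"
      by (intro LIMSEQ_le_const[OF tendsto_add[OF tendsto_const h(2)]]) auto
    then show ?thesis by (simp add: c_def)
  qed
  then show ?thesis by blast
qed

end

section \<open>Finite codimension and closed subspaces\<close>

text \<open>A dimension count modulo \<open>M\<close>, done by Gaussian elimination without forming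
  the quotient. If some vector involves the generator \<open>v\<close>, it serves as pivot and is
  subtracted from the others, which costs one vector and one generator. Indexing the vectors allows
  repetitions among them.\<close>

lemma (in vector_space) nontrivial_combination_in_subspace:
  assumes "finite F" "subspace M" "finite I" "card F < card I" "\<And>i. i \<in> I \<Longrightarrow> x i \<in> span (M \<union> F)"
  shows "\<exists>c. (\<exists>i\<in>I. c i \<noteq> 0) \<and> (\<Sum>i\<in>I. scale (c i) (x i)) \<in> M"
  using assms
proof (induction F arbitrary: I x rule: finite_induct)
  case empty
  then obtain j where j: "j \<in> I" by fastforce
  have "(\<Sum>i\<in>I. scale (if i = j then 1 else 0) (x i)) = (\<Sum>i\<in>I. if i = j then x i else 0)"
    by (intro sum.cong) auto
  also have "\<dots> = x j" using j empty.prems(2) by simp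
  also have "\<dots> \<in> M" using empty.prems(1,4) j by (metis span_eq_iff sup_bot_right)
  finally show ?case using j by (intro exI[of _ "\<lambda>i. if i = j then 1 else 0"]) auto
next
  case (insert v F)
  have "\<exists>k. x i - scale k v \<in> span (M \<union> F)" if "i \<in> I" for i
    using insert.prems(4)[OF that] span_breakdown_eq[of "x i" v "M \<union> F"] by simp
  then obtain a where a: "\<And>i. i \<in> I \<Longrightarrow> x i - scale (a i) v \<in> span (M \<union> F)" by metis
  show ?case
  proof (cases "\<forall>i\<in>I. a i = 0")
    case True
    then show ?thesis using a insert by simp
  next
    case False
    then obtain j where j: "j \<in> I" "a j \<noteq> 0" by blast
    define y where "y i = x i - scale (a i / a j) (x j)" for i
    have y: "y i \<in> span (M \<union> F)" if "i \<in> I - {j}" for i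
    proof -
      have "y i = (x i - scale (a i) v) - scale (a i / a j) (x j - scale (a j) v)"
        using j by (simp add: y_def scale_right_diff_distrib)
      with that show ?thesis by (simp add: span_diff span_scale a j)
    qed
    have "card F < card (I - {j})"
      using insert.prems j insert.hyps by simp
    with insert.IH[of "I - {j}" y] insert.prems y obtain c where
      c: "\<exists>i\<in>I - {j}. c i \<noteq> 0" "(\<Sum>i\<in>I - {j}. scale (c i) (y i)) \<in> M" by auto
    \<comment> \<open>The coefficient of the pivot collects all the multiples of \<open>x j\<close>
      that were subtracted in forming the \<open>y i\<close>.\<close>
    define c' where "c' = c(j := - (\<Sum>i\<in>I - {j}. c i * (a i / a j)))"
    have "(\<Sum>i\<in>I. scale (c' i) (x i)) = scale (c' j) (x j) + (\<Sum>i\<in>I - {j}. scale (c i) (x i))"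
      using insert.prems(2) j by (simp add: sum.remove c'_def)
    also have "\<dots> = (\<Sum>i\<in>I - {j}. scale (c i) (y i))"
      by (simp add: c'_def y_def scale_right_diff_distrib sum_subtractf scale_sum_left)
    finally have "(\<Sum>i\<in>I. scale (c' i) (x i)) \<in> M" using c by simp
    with c(1) show ?thesis by (intro exI[of _ c']) (auto simp: c'_def)
  qed
qed

context normed_function_space
begin

section \<open>Bounded operators and the preservation of closed subspaces\<close>

lemma bounded_operatorD:
  assumes "bounded_operator T"
  shows "f \<in> B \<Longrightarrow> T f \<in> B" "f \<in> B \<Longrightarrow> g \<in> B \<Longrightarrow> T (f + g) = T f + T g"
    "f \<in> B \<Longrightarrow> T (cscale c f) = cscale c (T f)"
    "f \<in> B \<Longrightarrow> g \<in> B \<Longrightarrow> T (f - g) = T f - T g"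
proof -
  show *: "f \<in> B \<Longrightarrow> T f \<in> B" "f \<in> B \<Longrightarrow> g \<in> B \<Longrightarrow> T (f + g) = T f + T g"
    "f \<in> B \<Longrightarrow> T (cscale c f) = cscale c (T f)" for f g c
    using assms by (auto simp: bounded_operator_def)
  show "f \<in> B \<Longrightarrow> g \<in> B \<Longrightarrow> T (f - g) = T f - T g"
    using *(2)[OF B_diff, of f g g] by simp
qed

lemma bounded_operator_tendsto:
  assumes T: "bounded_operator T" and s: "\<And>n. s n \<in> B" "x \<in> B" "(\<lambda>n. nm (s n - x)) \<longlonglongrightarrow> 0"
  shows "(\<lambda>n. nm (T (s n) - T x)) \<longlonglongrightarrow> 0"
proof -
  have "\<exists>K. \<forall>f\<in>B. nm (T f) \<le> K * nm f" using T by (simp add: bounded_operator_def)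
  then obtain K where K: "\<forall>f\<in>B. nm (T f) \<le> K * nm f" ..
  show ?thesis
  proof (rule tendsto_sandwich[OF _ _ tendsto_const])
    have "0 \<le> nm (T (s n) - T x)" for n
      by (rule nm_nonneg[OF B_diff[OF bounded_operatorD(1)[OF T s(1)] bounded_operatorD(1)[OF T s(2)]]])
    then show "\<forall>\<^sub>F n in sequentially. 0 \<le> nm (T (s n) - T x)"
      by (rule always_eventually[OF allI])
    have "nm (T (s n) - T x) \<le> K * nm (s n - x)" for n
      using bspec[OF K B_diff[OF s(1,2)]] unfolding bounded_operatorD(4)[OF T s(1,2)] .
    then show "\<forall>\<^sub>F n in sequentially. nm (T (s n) - T x) \<le> K * nm (s n - x)"
      by (rule always_eventually[OF allI])
    show "(\<lambda>n. K * nm (s n - x)) \<longlonglongrightarrow> 0"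
      using tendsto_mult[OF tendsto_const s(3), of K] by simp
  qed
qed

lemma closedin_vimage_bounded_operator:
  assumes T: "bounded_operator T" and W: "closedin mtopology W"
  shows "closedin mtopology {f\<in>B. T f \<in> W}"
  unfolding closedin_iff_nm
proof (intro conjI allI impI)
  fix s x assume a: "\<forall>n. s n \<in> {f \<in> B. T f \<in> W}" "x \<in> B" "(\<lambda>n. nm (s n - x)) \<longlonglongrightarrow> 0"
  then have s: "s n \<in> B" "T (s n) \<in> W" for n by blast+
  have "T x \<in> W"
    by (rule closedinD_nm[OF W s(2) bounded_operatorD(1)[OF T a(2)]
          bounded_operator_tendsto[OF T s(1) a(2,3)]])
  with a(2) show "x \<in> {f \<in> B. T f \<in> W}" by simp
qed auto

lemma subspace_image_bounded_operator:
  assumes T: "bounded_operator T" and W: "cfun.subspace W" "W \<subseteq> B"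
  shows "cfun.subspace (T ` W)"
proof (rule cfun.subspaceI)
  have "0 = T 0" using bounded_operatorD(4)[OF T B_0 B_0] by simp
  then show "0 \<in> T ` W" using cfun.subspace_0[OF W(1)] by (rule image_eqI)
next
  fix x y assume "x \<in> T ` W" "y \<in> T ` W"
  then obtain f g where "f \<in> W" "g \<in> W" "x = T f" "y = T g" by blast
  moreover from this W have "T (f + g) = T f + T g"
    using bounded_operatorD(2)[OF T] by blast
  ultimately show "x + y \<in> T ` W"
    using cfun.subspace_add[OF W(1)] by (metis image_eqI)
next
  fix x c assume "x \<in> T ` W"
  then obtain f where "f \<in> W" "x = T f" by blast
  moreover from this W have "T (cscale c f) = cscale c (T f)"
    using bounded_operatorD(3)[OF T] by blast
  ultimately show "cscale c x \<in> T ` W"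
    using cfun.subspace_scale[OF W(1)] by (metis image_eqI)
qed

text \<open>The closed range is complete, so the closed graph theorem makes the inverse bounded.
  Hence convergence of images forces convergence of their preimages, and the limit of the preimages
  stays in \<open>C\<close>.\<close>

theorem closedin_image_bounded_operator:
  assumes mcomplete and T: "bounded_operator T" and inj: "inj_on T B"
    and range: "closedin mtopology (T ` B)" and C: "closedin mtopology C"
  shows "closedin mtopology (T ` C)"
proof -
  have RB: "T ` B \<subseteq> B" and CB: "C \<subseteq> B"
    using bounded_operatorD(1)[OF T] C by (auto simp: closedin_iff_nm)
  \<comment> \<open>The range with the restricted norm is a space in its own right, to serve as the
    domain of the inverse.\<close>
  interpret R: normed_function_space "T ` B" nm
    using subspace_image_bounded_operator[OF T subspace_B] RB
    by unfold_locales (auto intro: nm_nonneg nm_triangle simp: subset_iff nm_eq_0_iff nm_cscale)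
  have "R.mcomplete"
  proof (rule R.mcomplete_if_nm)
    fix s :: "nat \<Rightarrow> complex \<Rightarrow> complex"
    assume s: "\<And>n. s n \<in> T ` B" "\<And>e. e > 0 \<Longrightarrow> \<exists>N. \<forall>m\<ge>N. \<forall>n\<ge>N. nm (s m - s n) < e"
    have sB: "s n \<in> B" for n using s(1) RB by blast
    obtain x where x: "x \<in> B" "(\<lambda>n. nm (s n - x)) \<longlonglongrightarrow> 0"
      using mcompleteD_nm[of s, OF \<open>mcomplete\<close> sB s(2)] by blast
    have "x \<in> T ` B" by (rule closedinD_nm[OF range s(1) x])
    with x show "\<exists>x\<in>T ` B. (\<lambda>n. nm (s n - x)) \<longlonglongrightarrow> 0" by blast
  qed
  define S where "S = inv_into B T"
  have ST: "S (T f) = f" if "f \<in> B" for f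
    using inj that by (simp add: S_def)
  have "\<exists>K. \<forall>f\<in>T ` B. nm (S f) \<le> K * nm f"
  proof (rule R.closed_graph[OF \<open>R.mcomplete\<close> normed_function_space_axioms \<open>mcomplete\<close>])
    show "S f \<in> B" if "f \<in> T ` B" for f using that ST by auto
    show "S (f + g) = S f + S g" if fg: "f \<in> T ` B" "g \<in> T ` B" for f g
    proof -
      obtain u v where "f = T u" "u \<in> B" "g = T v" "v \<in> B"
        using fg by (elim imageE)
      then show ?thesis
        using bounded_operatorD(2)[OF T, of u v] ST[OF B_add, of u v] ST[of u] ST[of v] by simp
    qed
    show "S (cscale c f) = cscale c (S f)" if f: "f \<in> T ` B" for f c
    proof -
      obtain u where "f = T u" "u \<in> B" using f by (rule imageE)
      then show ?thesis
        using bounded_operatorD(3)[OF T, of u] ST[OF B_scale, of u] ST[of u] by simp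
    qed
    fix s f h
    assume s: "\<And>n. s n \<in> T ` B" and f: "f \<in> T ` B" and h: "h \<in> B"
      and lim: "(\<lambda>n. nm (s n - f)) \<longlonglongrightarrow> 0" "(\<lambda>n. nm (S (s n) - h)) \<longlonglongrightarrow> 0"
    have SsB: "S (s n) \<in> B" and TS: "T (S (s n)) = s n" for n
      using s[of n] ST by auto
    \<comment> \<open>Continuity of \<open>T\<close> closes the graph of \<open>S\<close>: the
      \<open>s n\<close> tend to \<open>f\<close> and to \<open>T h\<close>, so uniqueness of limits
      gives \<open>f = T h\<close>.\<close>
    have lim': "(\<lambda>n. nm (s n - T h)) \<longlonglongrightarrow> 0"
      using bounded_operator_tendsto[OF T SsB h lim(2)] by (simp only: TS)
    have sB: "s n \<in> B" for n using s RB by blast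
    have "f \<in> B" "T h \<in> B" using f h RB by blast+
    then have "limitin mtopology s f sequentially" "limitin mtopology s (T h) sequentially"
      using limitin_iff_nm[OF sB] lim(1) lim' by simp_all
    then have "f = T h" by (rule limitin_metric_unique) simp
    with ST h show "S f = h" by simp
  qed
  then obtain K where "\<And>f. f \<in> T ` B \<Longrightarrow> nm (S f) \<le> K * nm f" by blast
  then have K: "nm f \<le> K * nm (T f)" if "f \<in> B" for f
    using that ST by (metis imageI)
  show ?thesis
    unfolding closedin_iff_nm
  proof (intro conjI allI impI)
    fix s x assume a: "\<forall>n. s n \<in> T ` C" "x \<in> B" "(\<lambda>n. nm (s n - x)) \<longlonglongrightarrow> 0"
    then have sB: "s n \<in> T ` B" for n using CB by blast
    have "x \<in> T ` B" by (rule closedinD_nm[OF range sB a(2,3)])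
    then obtain f where f: "f \<in> B" "x = T f" by blast
    from a obtain u where u: "\<And>n. u n \<in> C" "\<And>n. s n = T (u n)" unfolding image_iff by metis
    with CB have uB: "\<And>n. u n \<in> B" by blast
    have le: "nm (u n - f) \<le> K * nm (s n - x)" for n
      using K[OF B_diff[OF uB f(1)]] bounded_operatorD(4)[OF T uB f(1)] u f by simp
    have "(\<lambda>n. nm (u n - f)) \<longlonglongrightarrow> 0"
    proof (rule tendsto_sandwich[OF _ _ tendsto_const])
      show "\<forall>\<^sub>F n in sequentially. 0 \<le> nm (u n - f)"
        by (rule always_eventually[OF allI[OF nm_nonneg[OF B_diff[OF uB f(1)]]]])
      show "\<forall>\<^sub>F n in sequentially. nm (u n - f) \<le> K * nm (s n - x)"
        by (rule always_eventually[OF allI[OF le]])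
      show "(\<lambda>n. K * nm (s n - x)) \<longlonglongrightarrow> 0"
        using tendsto_mult[OF tendsto_const a(3), of K] by simp
    qed
    then have "f \<in> C" by (rule closedinD_nm[OF C u(1) f(1)])
    with f show "x \<in> T ` C" by blast
  qed (use CB RB in blast)
qed

text \<open>A vector outside the closed \<open>M\<close> has positive distance from it, so the norm
  of \<open>m + cscale c v\<close> controls \<open>c\<close>. In a convergent sequence the scalar
  coefficients are then Cauchy; subtracting their limit part leaves a convergent sequence in
  \<open>M\<close>.\<close>

lemma closedin_span_insert:
  assumes M: "closedin mtopology M" "cfun.subspace M" and v: "v \<in> B"
  shows "closedin mtopology (cfun.span (insert v M))"
proof (cases "v \<in> M")
  case True
  show ?thesis
    using M(1) by (simp only: insert_absorb[OF True] cfun.span_eq_iff[THEN iffD2, OF M(2)])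
next
  case False
  have MB: "M \<subseteq> B" using M by (simp add: closedin_iff_nm)
  have "\<exists>d>0. \<forall>m\<in>M. d \<le> nm (m - v)"
  proof (rule ccontr)
    assume "\<not> ?thesis"
    then have "\<exists>m\<in>M. nm (m - v) < 1 / real (Suc n)" for n
      by (metis not_le of_nat_0_less_iff zero_less_Suc zero_less_divide_1_iff)
    then obtain m where m: "\<And>n. m n \<in> M" "\<And>n. nm (m n - v) < 1 / real (Suc n)" by metis
    have "(\<lambda>n. nm (m n - v)) \<longlonglongrightarrow> 0"
    proof (rule tendsto_sandwich[OF _ _ tendsto_const LIMSEQ_Suc[OF lim_1_over_n]])
      show "\<forall>\<^sub>F n in sequentially. 0 \<le> nm (m n - v)"
        using m(1) MB v by (intro always_eventually allI nm_nonneg B_diff) auto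
      show "\<forall>\<^sub>F n in sequentially. nm (m n - v) \<le> 1 / of_nat (Suc n)"
        by (rule always_eventually[OF allI[OF less_imp_le[OF m(2)]]])
    qed
    then have "v \<in> M" by (rule closedinD_nm[OF M(1) m(1) v])
    with False show False ..
  qed
  then obtain d where d: "d > 0" "\<And>m. m \<in> M \<Longrightarrow> d \<le> nm (m - v)" by blast
  have coeff: "cmod c * d \<le> nm (m + cscale c v)" if m: "m \<in> M" for c m
  proof (cases "c = 0")
    case True
    then show ?thesis using m MB nm_nonneg B_add B_scale v by auto
  next
    case False
    \<comment> \<open>Factoring out \<open>- c\<close> turns the norm into a multiple of the
      distance from \<open>v\<close> to a point of \<open>M\<close>.\<close>
    have "m + cscale c v = cscale (- c) (cscale (- 1 / c) m - v)"
      using False by (auto simp: cscale_def fun_eq_iff algebra_simps)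
    then have "nm (m + cscale c v) = cmod c * nm (cscale (- 1 / c) m - v)"
      using MB m by (simp only: nm_cscale[OF B_diff[OF B_scale[OF subsetD] v]] norm_minus_cancel)
    then show ?thesis
      by (simp only: mult_left_mono[OF d(2)[OF cfun.subspace_scale[OF M(2) m]] norm_ge_zero])
  qed
  have span: "cfun.span (insert v M) = {m + cscale c v | m c. m \<in> M}"
  proof -
    have "x - cscale k v \<in> M \<longleftrightarrow> (\<exists>m\<in>M. x = m + cscale k v)" for x k
      by (metis add_diff_cancel_right' diff_add_cancel)
    then show ?thesis
      unfolding cfun.span_insert cfun.span_eq_iff[THEN iffD2, OF M(2)] by blast
  qed
  show ?thesis
    unfolding closedin_iff_nm
  proof (intro conjI allI impI)
    show "cfun.span (insert v M) \<subseteq> B"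
      using v MB by (intro cfun.span_minimal subspace_B) auto
    fix s x assume a: "\<forall>n. s n \<in> cfun.span (insert v M)" "x \<in> B" "(\<lambda>n. nm (s n - x)) \<longlonglongrightarrow> 0"
    have "\<exists>m c. m \<in> M \<and> s n = m + cscale c v" for n using a(1) unfolding span by blast
    then obtain m c where m: "\<And>n. m n \<in> M" and s: "\<And>n. s n = m n + cscale (c n) v" by metis
    have sB: "s n \<in> B" for n using m MB v by (auto simp: s intro!: B_add B_scale)
    have diff: "cmod (c j - c k) * d \<le> nm (s j - s k)" for j k
    proof -
      have "s j - s k = (m j - m k) + cscale (c j - c k) v"
        by (auto simp: s cscale_def fun_eq_iff algebra_simps)
      then show ?thesis using coeff[OF cfun.subspace_diff[OF M(2) m m]] by simp
    qed
    have "Cauchy c"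
    proof (rule metric_CauchyI)
      fix e :: real assume e: "e > 0"
      have "\<forall>\<^sub>F n in sequentially. nm (s n - x) < e * d / 2"
        using e d by (intro order_tendstoD(2)[OF a(3)]) simp
      then obtain N where N: "\<And>n. n \<ge> N \<Longrightarrow> nm (s n - x) < e * d / 2"
        unfolding eventually_sequentially by blast
      have "dist (c j) (c k) < e" if "j \<ge> N" "k \<ge> N" for j k
      proof -
        have "cmod (c j - c k) * d < e * d"
          using diff[of j k] nm_triangle_diff[OF sB[of j] a(2) sB[of k]] N[OF that(1)] N[OF that(2)]
            nm_diff_commute[OF sB[of k] a(2)] by linarith
        then show ?thesis using d by (simp add: dist_norm)
      qed
      then show "\<exists>N. \<forall>j\<ge>N. \<forall>k\<ge>N. dist (c j) (c k) < e" by blast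
    qed
    then obtain l where l: "c \<longlonglongrightarrow> l" using Cauchy_convergent convergent_def by blast
    let ?y = "x - cscale l v"
    have yB: "?y \<in> B" using a v by (intro B_diff B_scale)
    have "(\<lambda>n. nm (m n - ?y)) \<longlonglongrightarrow> 0"
    proof (rule tendsto_sandwich[OF _ _ tendsto_const])
      show "\<forall>\<^sub>F n in sequentially. 0 \<le> nm (m n - ?y)"
        using m MB by (intro always_eventually allI nm_nonneg B_diff[OF _ yB]) auto
      have "nm (m n - ?y) \<le> nm (s n - x) + cmod (c n - l) * nm v" for n
      proof -
        have "m n - ?y = (s n - x) - cscale (c n - l) v"
          by (auto simp: s cscale_def fun_eq_iff algebra_simps)
        then show ?thesis
          using nm_diff_le[OF B_diff[OF sB[of n] a(2)] B_scale[OF v, of "c n - l"]]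
          by (simp only: nm_cscale[OF v])
      qed
      then show "\<forall>\<^sub>F n in sequentially. nm (m n - ?y) \<le> nm (s n - x) + cmod (c n - l) * nm v"
        by simp
      have "(\<lambda>n. nm (s n - x) + cmod (c n - l) * nm v) \<longlonglongrightarrow> 0 + cmod (l - l) * nm v"
        by (intro tendsto_intros a l)
      then show "(\<lambda>n. nm (s n - x) + cmod (c n - l) * nm v) \<longlonglongrightarrow> 0" by simp
    qed
    then have "?y \<in> M" by (rule closedinD_nm[OF M(1) m yB])
    moreover have "x = ?y + cscale l v" by simp
    ultimately show "x \<in> cfun.span (insert v M)" unfolding span by blast
  qed
qed

lemma closedin_span_Un_finite:
  assumes "finite F" "F \<subseteq> B" "closedin mtopology M" "cfun.subspace M"
  shows "closedin mtopology (cfun.span (M \<union> F))"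
  using assms
proof (induction F rule: finite_induct)
  case empty
  show ?case
    using empty(2) by (simp only: Un_empty_right cfun.span_eq_iff[THEN iffD2, OF empty(3)])
next
  case (insert v F)
  have "cfun.span (insert v (cfun.span (M \<union> F))) = cfun.span (M \<union> insert v F)"
    by (simp add: cfun.span_insert cfun.span_span)
  moreover have "closedin mtopology (cfun.span (insert v (cfun.span (M \<union> F))))"
    using insert by (intro closedin_span_insert) auto
  ultimately show ?case by simp
qed

end

section \<open>Holomorphic functions and multipliers on the disk\<close>

text \<open>Induction on the zero set: each step removes one zero with its full multiplicity, so the
  set shrinks by exactly that point and the multiplicities go into \<open>q\<close>.\<close>

lemma holomorphic_factor_finite_zeros:
  assumes S: "open S" "connected S" "S \<noteq> {}" and "finite {z\<in>S. f z = 0}" "f holomorphic_on S"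
  shows "\<exists>q g. {z. poly q z = 0} \<subseteq> S \<and> g holomorphic_on S \<and>
    (\<forall>z\<in>S. g z \<noteq> 0 \<and> f z = poly q z * g z)"
  using assms(4,5)
proof (induction "{z\<in>S. f z = 0}" arbitrary: f rule: finite_induct)
  case empty
  then show ?case by (intro exI[of _ 1] exI[of _ f]) auto
next
  case (insert a Z)
  have a: "a \<in> S" "f a = 0" using insert.hyps(4) by blast+
  have fin: "finite {z\<in>S. f z = 0}" using insert.hyps(1) by (simp flip: insert.hyps(4))
  \<comment> \<open>A constant function vanishing at \<open>a\<close> would vanish on all of
    \<open>S\<close>, and a nonempty open set is infinite.\<close>
  have "\<not> f constant_on S"
  proof
    assume "f constant_on S"
    with a have "{z\<in>S. f z = 0} = S" by (force simp: constant_on_def)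
    with fin S show False using finite_imp_not_open by auto
  qed
  then obtain l r n where r: "0 < n" "0 < r" "ball a r \<subseteq> S" and l: "l holomorphic_on ball a r"
    and fl: "\<And>w. w \<in> ball a r \<Longrightarrow> f w = (w - a) ^ n * l w" and l0: "\<And>w. w \<in> ball a r \<Longrightarrow> l w \<noteq> 0"
    using holomorphic_factor_zero_nonconstant[OF insert.prems S(1,2) a] by metis
  \<comment> \<open>The local factor \<open>l\<close> fills the removable singularity of the
    quotient at \<open>a\<close>; the two formulas agree on the punctured ball.\<close>
  define h where "h z = (if z \<in> ball a r then l z else f z / (z - a) ^ n)" for z
  have h: "h z = f z / (z - a) ^ n" if "z \<noteq> a" for z
    using that by (simp add: h_def fl)
  have fh: "f z = (z - a) ^ n * h z" if "z \<in> S" for z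
    using a(2) r(1) by (cases "z = a") (simp_all add: h power_0_left)
  have "h holomorphic_on ball a r \<union> (S - {a})"
  proof (rule holomorphic_on_Un)
    show "h holomorphic_on ball a r"
      using l by (rule holomorphic_transform) (simp add: h_def)
    have "(\<lambda>z. f z / (z - a) ^ n) holomorphic_on S - {a}"
      by (intro holomorphic_intros holomorphic_on_subset[OF insert.prems]) auto
    then show "h holomorphic_on S - {a}"
      by (rule holomorphic_transform) (simp add: h)
  qed (use S in \<open>auto simp: open_delete\<close>)
  moreover have "ball a r \<union> (S - {a}) = S" using r a by auto
  ultimately have hol: "h holomorphic_on S" by simp
  have ha: "h a \<noteq> 0" using l0 r by (simp add: h_def)
  have "(z \<in> S \<and> h z = 0) \<longleftrightarrow> (z \<in> S \<and> f z = 0) \<and> z \<noteq> a" for z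
    using ha by (cases "z = a") (simp_all add: h)
  then have "{z\<in>S. h z = 0} = {z\<in>S. f z = 0} - {a}" by blast
  also have "\<dots> = Z" using insert.hyps by blast
  finally obtain q g where q: "{z. poly q z = 0} \<subseteq> S" "g holomorphic_on S"
    "\<forall>z\<in>S. g z \<noteq> 0 \<and> h z = poly q z * g z"
    using insert.hyps(3)[of h] hol by blast
  show ?case
  proof (intro exI conjI ballI)
    show "{z. poly ([:- a, 1:] ^ n * q) z = 0} \<subseteq> S" using q a by auto
    show "f z = poly ([:- a, 1:] ^ n * q) z * g z" if "z \<in> S" for z
      using q that fh[OF that] by simp
  qed (use q in auto)
qed

section \<open>Multiplication of functions vanishing off the disk, and division by a linear
  factor\<close>

lemma sum_fun_apply: "(\<Sum>i\<in>I. f i) x = (\<Sum>i\<in>I. f i x)"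
  by (induction I rule: infinite_finite_induct) auto

lemma mult_op_mult_op: "mult_op \<phi> (mult_op \<rho> f) = mult_op (\<lambda>z. \<phi> z * \<rho> z) f"
  by (simp add: mult_op_def mult.assoc)

lemma mult_op_on_disk: "mult_op \<phi> (on_disk f) = on_disk (\<lambda>z. \<phi> z * f z)"
  by (auto simp: mult_op_def on_disk_def)

lemma hol_disk_on_disk: "f holomorphic_on ball 0 1 \<Longrightarrow> on_disk f \<in> hol_disk"
  unfolding hol_disk_def on_disk_def by (auto intro: holomorphic_transform)

lemma hol_disk_mult_op: "\<phi> holomorphic_on ball 0 1 \<Longrightarrow> f \<in> hol_disk \<Longrightarrow> mult_op \<phi> f \<in> hol_disk"
  unfolding hol_disk_def mult_op_def by (auto intro: holomorphic_intros)

lemma mult_op_cong: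
  assumes "f \<in> hol_disk" "\<And>z. z \<in> ball 0 1 \<Longrightarrow> \<phi> z = \<rho> z"
  shows "mult_op \<phi> f = mult_op \<rho> f"
  using assms by (force simp: mult_op_def hol_disk_def)

lemma mult_op_cancel:
  assumes "f \<in> hol_disk" "g \<in> hol_disk" "\<And>z. z \<in> ball 0 1 \<Longrightarrow> \<phi> z \<noteq> 0" "mult_op \<phi> f = mult_op \<phi> g"
  shows "f = g"
proof
  fix z
  show "f z = g z"
  proof (cases "z \<in> ball 0 1")
    case True
    with assms(3)[OF True] fun_cong[OF assms(4), of z] show ?thesis by (simp add: mult_op_def)
  qed (use assms in \<open>simp add: hol_disk_def\<close>)
qed

text \<open>The disk minus a finite set is open and nonempty, so the identity theorem applies; off
  the disk both functions are \<open>0\<close>. This permits cancelling a factor that has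
  zeros.\<close>

lemma hol_disk_eqI:
  assumes f: "f \<in> hol_disk" and g: "g \<in> hol_disk" and Z: "finite Z"
    and eq: "\<And>z. z \<in> ball 0 1 - Z \<Longrightarrow> f z = g z"
  shows "f = g"
proof
  fix z
  have "infinite (ball (0::complex) 1)" using finite_imp_not_open[of "ball (0::complex) 1"] by auto
  then have ne: "ball (0::complex) 1 - Z \<noteq> {}" using Z by (metis finite_Diff2 finite.emptyI)
  show "f z = g z"
  proof (cases "z \<in> ball 0 1")
    case True
    show ?thesis
      by (rule analytic_continuation_open[of "ball 0 1 - Z" "ball 0 1"])
        (use f g ne Z eq True in \<open>auto simp: hol_disk_def finite_imp_closed open_Diff\<close>)
  qed (use f g in \<open>simp add: hol_disk_def\<close>)
qed

lemma hol_disk_divide_zero: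
  assumes f: "f \<in> hol_disk" and a: "a \<in> ball 0 1" "f a = 0"
  shows "\<exists>h\<in>hol_disk. f = mult_op (poly [:- a, 1:]) h"
proof -
  \<comment> \<open>The difference quotient with the derivative as its value at \<open>a\<close> is
    holomorphic by removability of the singularity.\<close>
  define h where "h z = (if z = a then deriv f a else (f z - f a) / (z - a))" for z
  have "h holomorphic_on ball 0 1"
    unfolding h_def by (rule pole_lemma_open) (use f in \<open>auto simp: hol_disk_def\<close>)
  then have "on_disk h \<in> hol_disk" by (rule hol_disk_on_disk)
  moreover have "f = mult_op (poly [:- a, 1:]) (on_disk h)"
    using f a by (auto simp: mult_op_def on_disk_def h_def hol_disk_def fun_eq_iff)
  ultimately show ?thesis by blast
qed

section \<open>Multipliers and their boundedness as operators\<close>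

lemma (in normed_function_space) multiplier_mult:
  assumes "multiplier B \<phi>" "multiplier B \<rho>"
  shows "multiplier B (\<lambda>z. \<phi> z * \<rho> z)"
  using assms unfolding multiplier_def
  by (auto intro: holomorphic_intros simp flip: mult_op_mult_op)

lemma (in normed_function_space) multiplier_power:
  assumes "multiplier B \<phi>"
  shows "multiplier B (\<lambda>z. \<phi> z ^ k)"
proof (induction k)
  case 0
  show ?case by (simp add: multiplier_def mult_op_def)
next
  case (Suc k)
  with multiplier_mult[OF assms Suc] show ?case by simp
qed

context disk_banach_space
begin

lemma B_hol_disk: "f \<in> B \<Longrightarrow> f \<in> hol_disk"
  using holomorphic by blast

lemma tendsto_eval:
  assumes "\<And>n. s n \<in> B" "x \<in> B" "(\<lambda>n. nm (s n - x)) \<longlonglongrightarrow> 0" "z \<in> ball 0 1"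
  shows "(\<lambda>n. s n z) \<longlonglongrightarrow> x z"
proof -
  have "limitin mtopology s x sequentially"
    using assms(3) by (simp only: limitin_iff_nm[OF assms(1,2)])
  from continuous_map_limit[OF point_evaluation[OF assms(4)] this] show ?thesis
    by (simp add: o_def)
qed

text \<open>The graph is closed because norm limits are pointwise limits: evaluating at a point of
  the disk shows that the limit of the products must be \<open>mult_op \<phi> f\<close>.\<close>

theorem multiplier_bounded_operator:
  assumes \<phi>: "multiplier B \<phi>"
  shows "bounded_operator (mult_op \<phi>)"
proof -
  have mB: "mult_op \<phi> f \<in> B" if "f \<in> B" for f
    using \<phi> that by (simp add: multiplier_def)
  have add: "mult_op \<phi> (f + g) = mult_op \<phi> f + mult_op \<phi> g"
    and scale: "mult_op \<phi> (cscale c f) = cscale c (mult_op \<phi> f)" for f g c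
    by (auto simp: mult_op_def cscale_def algebra_simps)
  have "\<exists>K. \<forall>f\<in>B. nm (mult_op \<phi> f) \<le> K * nm f"
  proof (rule closed_graph[OF mcomplete_B normed_function_space_axioms mcomplete_B mB add scale])
    fix s f h assume s: "\<And>n. s n \<in> B" and f: "f \<in> B" and h: "h \<in> B"
      and lim: "(\<lambda>n. nm (s n - f)) \<longlonglongrightarrow> 0" "(\<lambda>n. nm (mult_op \<phi> (s n) - h)) \<longlonglongrightarrow> 0"
    show "mult_op \<phi> f = h"
    proof
      fix z
      show "mult_op \<phi> f z = h z"
      proof (cases "z \<in> ball 0 1")
        case True
        have "(\<lambda>n. \<phi> z * s n z) \<longlonglongrightarrow> \<phi> z * f z"
          by (intro tendsto_mult tendsto_const tendsto_eval[OF s f lim(1) True])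
        moreover have "(\<lambda>n. \<phi> z * s n z) \<longlonglongrightarrow> h z"
          using tendsto_eval[OF mB[OF s] h lim(2) True] by (simp add: mult_op_def)
        ultimately show ?thesis
          using LIMSEQ_unique by (fastforce simp: mult_op_def)
      qed (use B_hol_disk[OF f] B_hol_disk[OF h] in \<open>simp add: hol_disk_def mult_op_def\<close>)
    qed
  qed
  then show ?thesis
    unfolding bounded_operator_def using mB add scale by blast
qed

lemma subspace_image_multiplier:
  "multiplier B \<phi> \<Longrightarrow> cfun.subspace (mult_op \<phi> ` B)"
  by (rule subspace_image_bounded_operator[OF multiplier_bounded_operator subspace_B subset_refl])

lemma multiplier_image_subset: "multiplier B \<phi> \<Longrightarrow> mult_op \<phi> ` B \<subseteq> B"
  by (auto simp: multiplier_def)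

end

section \<open>Sufficiency\<close>

lemma mult_op_poly_mult: "mult_op (poly (p * q)) f = mult_op (poly p) (mult_op (poly q) f)"
  by (simp add: mult_op_def mult.assoc)

context admissible_space
begin

section \<open>Polynomial multipliers, bounded multipliers and division in \<open>B\<close>\<close>

lemma poly_in_B: "on_disk (poly p) \<in> B"
  using polynomials_subset by auto

lemma one_in_B: "on_disk (\<lambda>_. 1) \<in> B"
  using poly_in_B[of 1] by (simp add: poly_1[abs_def])

lemma multiplier_poly: "multiplier B (poly p)"
proof -
  have "mult_op (poly p) f \<in> B" if f: "f \<in> B" for f
  proof (induction p)
    case 0
    have "mult_op (poly 0) f = 0" by (simp add: mult_op_def zero_fun_def)
    then show ?case using B_0 by (simp only:)
  next
    case (pCons a p)
    have "mult_op (poly (pCons a p)) f = cscale a f + mult_op (\<lambda>z. z) (mult_op (poly p) f)"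
      by (auto simp: mult_op_def cscale_def algebra_simps)
    then show ?case
      using B_add[OF B_scale[OF f] bounded_operatorD(1)[OF bounded_Mz pCons.IH]] by (simp only:)
  qed
  then show ?thesis by (simp add: multiplier_def holomorphic_intros)
qed

lemma mult_op_poly_in_B: "f \<in> B \<Longrightarrow> mult_op (poly p) f \<in> B"
  using multiplier_poly by (simp add: multiplier_def)

text \<open>If \<open>cmod (\<phi> z)\<close> exceeded the operator norm, the functions \<open>(\<phi> / \<phi> z) ^ k\<close> would tend to \<open>0\<close> in
  norm while taking the value \<open>1\<close> at \<open>z\<close>.\<close>

lemma multiplier_bounded:
  assumes \<phi>: "multiplier B \<phi>"
  shows "\<exists>C. \<forall>z\<in>ball 0 1. cmod (\<phi> z) \<le> C"
proof -
  have "\<exists>K. \<forall>f\<in>B. nm (mult_op \<phi> f) \<le> K * nm f"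
    using multiplier_bounded_operator[OF \<phi>] by (simp add: bounded_operator_def)
  then obtain K where K: "\<forall>f\<in>B. nm (mult_op \<phi> f) \<le> K * nm f" ..
  define e where "e = on_disk (\<lambda>_. 1)"
  have eB: "e \<in> B" using one_in_B by (simp add: e_def)
  \<comment> \<open>Clipping at \<open>0\<close> makes the bound nonnegative, as iterating it to
    \<open>L ^ k\<close> requires.\<close>
  define L where "L = max K 0"
  have L: "nm (mult_op \<phi> f) \<le> L * nm f" if "f \<in> B" for f
  proof -
    have "nm (mult_op \<phi> f) \<le> K * nm f" using K that by blast
    also have "\<dots> \<le> L * nm f" by (intro mult_right_mono nm_nonneg that) (simp add: L_def)
    finally show ?thesis .
  qed
  have "cmod (\<phi> z) \<le> L" if z: "z \<in> ball 0 1" for z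
  proof (rule ccontr)
    assume "\<not> cmod (\<phi> z) \<le> L"
    then have gt: "cmod (\<phi> z) > L" by simp
    have L0: "L \<ge> 0" by (simp add: L_def)
    have pos: "cmod (\<phi> z) > 0" using gt L0 by linarith
    define s where "s k = cscale (1 / \<phi> z ^ k) (mult_op (\<lambda>w. \<phi> w ^ k) e)" for k
    have pB: "mult_op (\<lambda>w. \<phi> w ^ k) e \<in> B" for k
      using multiplier_power[OF \<phi>] eB by (simp add: multiplier_def)
    have sB: "s k \<in> B" for k unfolding s_def by (rule B_scale[OF pB])
    have pow: "nm (mult_op (\<lambda>w. \<phi> w ^ k) e) \<le> L ^ k * nm e" for k
    proof (induction k)
      case 0
      show ?case by (simp add: mult_op_def)
    next
      case (Suc k)
      have "mult_op (\<lambda>w. \<phi> w ^ Suc k) e = mult_op \<phi> (mult_op (\<lambda>w. \<phi> w ^ k) e)"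
        by (simp add: mult_op_mult_op)
      then have "nm (mult_op (\<lambda>w. \<phi> w ^ Suc k) e) \<le> L * nm (mult_op (\<lambda>w. \<phi> w ^ k) e)"
        using L[OF pB] by simp
      also have "\<dots> \<le> L * (L ^ k * nm e)" by (rule mult_left_mono[OF Suc L0])
      finally show ?case by simp
    qed
    have ns: "nm (s k) \<le> (L / cmod (\<phi> z)) ^ k * nm e" for k
    proof -
      have "nm (s k) = nm (mult_op (\<lambda>w. \<phi> w ^ k) e) / cmod (\<phi> z) ^ k"
        unfolding s_def nm_cscale[OF pB] by (simp add: norm_divide norm_power)
      also have "\<dots> \<le> L ^ k * nm e / cmod (\<phi> z) ^ k"
        by (rule divide_right_mono[OF pow]) simp
      finally show ?thesis by (simp add: power_divide)
    qed
    have "(\<lambda>k. (L / cmod (\<phi> z)) ^ k * nm e) \<longlonglongrightarrow> 0 * nm e"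
      by (intro tendsto_mult tendsto_const LIMSEQ_realpow_zero) (use gt L0 pos in auto)
    then have "(\<lambda>k. nm (s k)) \<longlonglongrightarrow> 0"
      by (intro tendsto_sandwich[OF always_eventually[OF allI[OF nm_nonneg[OF sB]]]
            always_eventually[OF allI[OF ns]] tendsto_const]) simp
    then have lim: "(\<lambda>k. nm (s k - 0)) \<longlonglongrightarrow> 0" by (simp only: diff_zero)
    have "(\<lambda>k. s k z) \<longlonglongrightarrow> 0 z"
      by (rule tendsto_eval[OF sB B_0 lim z])
    moreover have "s k z = 1" for k
      using z pos by (simp add: s_def cscale_def mult_op_def e_def on_disk_def)
    ultimately have "(\<lambda>k. 1 :: complex) \<longlonglongrightarrow> 0" by simp
    then show False by (simp add: LIMSEQ_const_iff)
  qed
  then show ?thesis by blast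
qed

text \<open>The quotient is holomorphic since the singularity at \<open>a\<close> is removable, and
  \<open>division\<close> for the single linear factor puts it into \<open>B\<close>.\<close>

lemma divide_zero:
  assumes f: "f \<in> B" and a: "a \<in> ball 0 1" "f a = 0"
  shows "\<exists>h\<in>B. f = mult_op (poly [:- a, 1:]) h"
proof -
  obtain h where h: "h \<in> hol_disk" "f = mult_op (poly [:- a, 1:]) h"
    using hol_disk_divide_zero[OF B_hol_disk[OF f] a] by blast
  have "h \<in> B"
  proof (rule division)
    show "z \<in> ball 0 1" if "poly [:- a, 1:] z = 0" for z using that a by simp
  qed (use h f in simp_all)
  with h show ?thesis by blast
qed

lemma multiplier_image_eq_B:
  assumes g: "multiplier B g" "bounded_away_from_0 g"
  shows "mult_op g ` B = B"
proof
  show "mult_op g ` B \<subseteq> B" by (rule multiplier_image_subset[OF g(1)])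
  show "B \<subseteq> mult_op g ` B"
  proof
    fix f assume f: "f \<in> B"
    have mem: "mult_op (\<lambda>z. 1 / g z) f \<in> B"
      using inverse_multiplier[OF g] f by (simp add: multiplier_def)
    have "mult_op g (mult_op (\<lambda>z. 1 / g z) f) = f"
    proof -
      have "z \<in> ball 0 1 \<Longrightarrow> g z \<noteq> 0" for z
        using g(2) unfolding bounded_away_from_0_def by fastforce
      then show ?thesis
        using mult_op_cong[OF B_hol_disk[OF f], of "\<lambda>z. g z * (1 / g z)" "\<lambda>_. 1"]
        by (simp add: mult_op_mult_op) (simp add: mult_op_def)
    qed
    then show "f \<in> mult_op g ` B" using imageI[OF mem, of "mult_op g"] by (simp only:)
  qed
qed

text \<open>Induction on the degree. Multiplication by \<open>z - a\<close> has as range the kernel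
  of the evaluation at \<open>a\<close>, which is closed and is complemented by the constants. Each
  linear factor therefore preserves injectivity and closedness and adds at most one dimension to the
  codimension.\<close>

lemma poly_image:
  assumes "{z. poly q z = 0} \<subseteq> ball 0 1"
  shows "inj_on (mult_op (poly q)) B \<and> closedin mtopology (mult_op (poly q) ` B) \<and>
    (\<exists>F. finite F \<and> F \<subseteq> B \<and> B \<subseteq> cfun.span (mult_op (poly q) ` B \<union> F))"
  using assms
proof (induction "degree q" arbitrary: q)
  case 0
  then obtain c where q: "q = [:c:]" by (metis degree_eq_zeroE)
  \<comment> \<open>The zero polynomial is excluded because it would have the root \<open>1\<close>,
    which lies outside the open disk.\<close>
  have c: "c \<noteq> 0"
  proof
    assume "c = 0"
    then have "1 \<in> {z. poly q z = 0}" by (simp add: q)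
    with 0(2) have "(1::complex) \<in> ball 0 1" by blast
    then show False by simp
  qed
  have "mult_op (poly q) = cscale c" by (auto simp: q mult_op_def cscale_def fun_eq_iff)
  moreover have "cscale c ` B = B"
  proof
    show "cscale c ` B \<subseteq> B" using B_scale by blast
    show "B \<subseteq> cscale c ` B"
    proof
      fix f assume "f \<in> B"
      moreover have "f = cscale c (cscale (1 / c) f)" using c by (simp add: cscale_def)
      ultimately show "f \<in> cscale c ` B" using B_scale by (metis image_eqI)
    qed
  qed
  moreover have "inj_on (cscale c) B"
    using c by (auto simp: inj_on_def cscale_def fun_eq_iff)
  moreover have "closedin mtopology B" using closedin_topspace[of mtopology] by simp
  moreover have "B \<subseteq> cfun.span (B \<union> {})" by (simp add: cfun.span_superset)
  ultimately show ?case by (metis finite.emptyI empty_subsetI)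
next
  case (Suc d)
  then obtain a where a: "poly q a = 0" using alg_closed_imp_poly_has_root[of q] by auto
  then obtain r where q: "q = [:- a, 1:] * r" by (metis dvdE poly_eq_0_iff_dvd)
  have aD: "a \<in> ball 0 1" using a Suc.prems by blast
  have "r \<noteq> 0" using Suc.hyps(2) q by auto
  then have "degree q = degree [:- a, 1:] + degree r"
    unfolding q by (intro degree_mult_eq) simp_all
  then have "d = degree r" using Suc.hyps(2) by simp
  moreover have "{z. poly r z = 0} \<subseteq> ball 0 1" using Suc.prems by (auto simp: q)
  ultimately obtain F where inj: "inj_on (mult_op (poly r)) B"
    and cl: "closedin mtopology (mult_op (poly r) ` B)"
    and F: "finite F" "F \<subseteq> B" "B \<subseteq> cfun.span (mult_op (poly r) ` B \<union> F)"
    using Suc.hyps(1)[of r] by blast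
  define T where "T = mult_op (poly [:- a, 1:])"
  have T: "bounded_operator T" unfolding T_def by (rule multiplier_bounded_operator[OF multiplier_poly])
  have qT: "mult_op (poly q) f = T (mult_op (poly r) f)" for f
    unfolding T_def q by (rule mult_op_poly_mult)
  have injT: "inj_on T B"
  proof (rule inj_onI)
    fix f g assume fg: "f \<in> B" "g \<in> B" "T f = T g"
    show "f = g"
    proof (rule hol_disk_eqI[OF B_hol_disk[OF fg(1)] B_hol_disk[OF fg(2)], of "{a}"])
      fix z assume "z \<in> ball 0 1 - {a}"
      with fun_cong[OF fg(3), of z] show "f z = g z" by (simp add: T_def mult_op_def)
    qed simp
  qed
  have TB: "T ` B = {f\<in>B. f a = 0}"
  proof
    show "T ` B \<subseteq> {f\<in>B. f a = 0}"
      using bounded_operatorD(1)[OF T] by (auto simp: T_def mult_op_def)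
    show "{f\<in>B. f a = 0} \<subseteq> T ` B" using divide_zero[OF _ aD] by (auto simp: T_def)
  qed
  have clT: "closedin mtopology (T ` B)"
    unfolding closedin_iff_nm TB
  proof (intro conjI allI impI)
    fix s x assume h: "\<forall>n. s n \<in> {f \<in> B. f a = 0}" "x \<in> B" "(\<lambda>n. nm (s n - x)) \<longlonglongrightarrow> 0"
    then have sB: "s n \<in> B" and s0: "s n a = 0" for n by blast+
    have "(\<lambda>n. s n a) \<longlonglongrightarrow> x a" by (rule tendsto_eval[OF sB h(2,3) aD])
    then have "x a = 0" by (simp add: s0 LIMSEQ_const_iff)
    with h(2) show "x \<in> {f \<in> B. f a = 0}" by blast
  qed blast
  have img: "mult_op (poly q) ` B = T ` (mult_op (poly r) ` B)"
    by (simp add: image_image qT)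
  have "closedin mtopology (mult_op (poly q) ` B)"
    unfolding img by (rule closedin_image_bounded_operator[OF mcomplete_B T injT clT cl])
  moreover have "inj_on (mult_op (poly q)) B"
  proof -
    have "inj_on (T \<circ> mult_op (poly r)) B"
      using inj inj_on_subset[OF injT multiplier_image_subset[OF multiplier_poly]]
      by (rule comp_inj_on)
    then show ?thesis by (simp add: inj_on_def qT)
  qed
  moreover have "B \<subseteq> cfun.span (mult_op (poly q) ` B \<union> insert (on_disk (\<lambda>_. 1)) (T ` F))"
    (is "_ \<subseteq> cfun.span ?G")
  proof
    fix f assume f: "f \<in> B"
    \<comment> \<open>The vectors that \<open>T\<close> sends into the span form a subspace
      containing the range of the cofactor \<open>r\<close> and the set \<open>F\<close>, hence all
      of \<open>B\<close>.\<close>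
    have sub: "{h\<in>B. T h \<in> cfun.span ?G} \<supseteq> cfun.span (mult_op (poly r) ` B \<union> F)"
    proof (rule cfun.span_minimal)
      show "mult_op (poly r) ` B \<union> F \<subseteq> {h \<in> B. T h \<in> cfun.span ?G}"
        using F(2) multiplier_image_subset[OF multiplier_poly]
        by (auto intro!: cfun.span_base simp flip: qT)
      show "cfun.subspace {h \<in> B. T h \<in> cfun.span ?G}"
        by (rule cfun.subspaceI)
          (use bounded_operatorD[OF T] in \<open>auto simp: B_0 B_add B_scale cfun.span_add cfun.span_scale
             T_def mult_op_def cfun.span_zero simp flip: zero_fun_def\<close>)
    qed
    define e where "e = on_disk (\<lambda>_. 1)"
    have eB: "e \<in> B" using one_in_B by (simp add: e_def)
    \<comment> \<open>Subtracting the constant \<open>f a\<close> lands in the kernel of the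
      evaluation at \<open>a\<close>, that is, in the range of \<open>T\<close>.\<close>
    have "(f - cscale (f a) e) a = 0" using aD by (simp add: e_def on_disk_def cscale_def)
    then have "f - cscale (f a) e \<in> T ` B"
      unfolding TB using B_diff[OF f B_scale[OF eB]] by blast
    then obtain h where h: "h \<in> B" "f - cscale (f a) e = T h" by (rule imageE)
    have "T h \<in> cfun.span ?G" using sub F(3) h(1) by blast
    moreover have "cscale (f a) e \<in> cfun.span ?G"
      by (intro cfun.span_scale cfun.span_base) (simp add: e_def)
    ultimately have "T h + cscale (f a) e \<in> cfun.span ?G" by (rule cfun.span_add)
    then show "f \<in> cfun.span ?G" by (simp flip: h(2))
  qed
  moreover have "finite (insert (on_disk (\<lambda>_. 1)) (T ` F))" using F by simp
  moreover have "insert (on_disk (\<lambda>_. 1)) (T ` F) \<subseteq> B"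
    using one_in_B F bounded_operatorD(1)[OF T] by blast
  ultimately show ?case by blast
qed

end

section \<open>Splitting a polynomial off a multiplier, and the Fredholm conclusion\<close>

lemma poly_monom_sum:
  fixes z :: "'a :: comm_semiring_1"
  shows "poly (\<Sum>i\<in>I. monom (c i) i) z = (\<Sum>i\<in>I. c i * z ^ i)"
  by (induction I rule: infinite_finite_induct) (simp_all add: poly_monom)

lemma mult_op_poly_on_disk: "mult_op (poly p) (on_disk (poly q)) = on_disk (poly (p * q))"
  by (simp add: mult_op_on_disk poly_mult[abs_def])

context admissible_space
begin

text \<open>Since \<open>q\<close> times \<open>g f\<close> is \<open>\<psi> f\<close>, an element
  of \<open>B\<close>, the axiom \<open>division\<close> returns \<open>g f\<close> to
  \<open>B\<close>.\<close>

lemma quotient_multiplier: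
  assumes \<psi>: "multiplier B \<psi>" and q: "{z. poly q z = 0} \<subseteq> ball 0 1"
    and g: "g holomorphic_on ball 0 1" and eq: "\<And>z. z \<in> ball 0 1 \<Longrightarrow> \<psi> z = poly q z * g z"
  shows "multiplier B g" and "f \<in> B \<Longrightarrow> mult_op \<psi> f = mult_op (poly q) (mult_op g f)"
proof -
  show *: "mult_op \<psi> f = mult_op (poly q) (mult_op g f)" if "f \<in> B" for f
    unfolding mult_op_mult_op by (rule mult_op_cong[OF B_hol_disk[OF that] eq])
  have "mult_op g f \<in> B" if f: "f \<in> B" for f
  proof (rule division)
    show "z \<in> ball 0 1" if "poly q z = 0" for z using q that by blast
    show "mult_op g f \<in> hol_disk" by (rule hol_disk_mult_op[OF g B_hol_disk[OF f]])
    show "mult_op (poly q) (mult_op g f) \<in> B"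
      using \<psi> f unfolding *[OF f, symmetric] by (simp add: multiplier_def)
  qed
  then show "multiplier B g" using g by (simp add: multiplier_def)
qed

text \<open>The zeros of \<open>\<psi>\<close> lie in a compact disk and are finite in number, so
  they can be split off into \<open>q\<close>. The remaining factor is bounded below: near the
  boundary because \<open>q\<close> is bounded above, further inside by compactness. It then maps
  \<open>B\<close> onto \<open>B\<close>, so \<open>\<psi>\<close> and \<open>q\<close> have the
  same range.\<close>

lemma fredholm_if_bounded_away:
  assumes \<psi>: "multiplier B \<psi>" and away: "bounded_away_from_0_near_boundary \<psi>"
  shows "fredholm (mult_op \<psi>)"
proof -
  obtain \<epsilon> r where \<epsilon>: "\<epsilon> > 0" and r: "0 < r" "r < 1"
    and lower: "\<And>z. r < cmod z \<Longrightarrow> cmod z < 1 \<Longrightarrow> cmod (\<psi> z) > \<epsilon>"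
    using away unfolding bounded_away_from_0_near_boundary_def by blast
  have hol: "\<psi> holomorphic_on ball 0 1" using \<psi> by (simp add: multiplier_def)
  \<comment> \<open>A point of the annulus, where \<open>\<psi>\<close> is nonzero; this shows that
    a constant \<open>\<psi>\<close> has no zeros at all.\<close>
  obtain b where b: "r < b" "b < 1" using dense[OF r(2)] by blast
  have "\<psi> (of_real b) \<noteq> 0" using lower[of "of_real b"] b r \<epsilon> by fastforce
  then have nz: "\<not> (\<forall>z\<in>ball 0 1. \<psi> z = 0)" using b r by (auto intro!: bexI[of _ "of_real b"])
  have "finite {z \<in> cball 0 r. \<psi> z = 0}"
  proof (cases "\<psi> constant_on ball 0 1")
    case True
    with nz r have "{z \<in> cball 0 r. \<psi> z = 0} = {}" by (force simp: constant_on_def)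
    then show ?thesis by (simp only: finite.emptyI)
  next
    case False
    have "cball 0 r \<subseteq> ball (0::complex) 1" using r by auto
    with False show ?thesis using holomorphic_compact_finite_zeros[OF hol, of "cball 0 r"] by simp
  qed
  moreover have "{z \<in> ball 0 1. \<psi> z = 0} \<subseteq> {z \<in> cball 0 r. \<psi> z = 0}"
  proof
    fix z assume z: "z \<in> {z \<in> ball 0 1. \<psi> z = 0}"
    then have "\<not> r < cmod z" using lower[of z] \<epsilon> by auto
    with z show "z \<in> {z \<in> cball 0 r. \<psi> z = 0}" by simp
  qed
  ultimately have "finite {z \<in> ball 0 1. \<psi> z = 0}" by (rule rev_finite_subset)
  then obtain q g where q: "{z. poly q z = 0} \<subseteq> ball 0 1" and g: "g holomorphic_on ball 0 1"
    and g0: "\<And>z. z \<in> ball 0 1 \<Longrightarrow> g z \<noteq> 0"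
    and eq: "\<And>z. z \<in> ball 0 1 \<Longrightarrow> \<psi> z = poly q z * g z"
    using holomorphic_factor_finite_zeros[of "ball 0 1" \<psi>] hol by auto
  note g_mult = quotient_multiplier[OF \<psi> q g eq]
  have "bounded_away_from_0 g"
  proof -
    have "compact (poly q ` cball 0 1)"
      by (intro compact_continuous_image continuous_intros compact_cball)
    then obtain M where M: "M > 0" "\<And>z. z \<in> cball 0 1 \<Longrightarrow> cmod (poly q z) \<le> M"
      by (auto dest!: compact_imp_bounded simp: bounded_pos)
    have outer: "cmod (g z) > \<epsilon> / M" if z: "r < cmod z" "cmod z < 1" for z
    proof -
      have "\<epsilon> < cmod (poly q z) * cmod (g z)"
        using lower[OF z] eq[of z] z by (simp add: norm_mult)
      also have "\<dots> \<le> M * cmod (g z)" using z by (intro mult_right_mono M) auto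
      finally show ?thesis using M by (simp add: field_simps)
    qed
    have "continuous_on (cball 0 r) (\<lambda>z. cmod (g z))"
      using r by (intro continuous_intros holomorphic_on_imp_continuous_on holomorphic_on_subset[OF g]) auto
    then obtain w where w: "w \<in> cball 0 r" "\<And>z. z \<in> cball 0 r \<Longrightarrow> cmod (g w) \<le> cmod (g z)"
      using continuous_attains_inf[of "cball 0 r" "\<lambda>z. cmod (g z)"] r by auto
    have gw: "cmod (g w) > 0" using g0[of w] w r by simp
    \<comment> \<open>Halving the attained minimum keeps the required inequality strict.\<close>
    define d where "d = min (\<epsilon> / M) (cmod (g w) / 2)"
    have "cmod (g z) > d" if z: "z \<in> ball 0 1" for z
    proof (cases "r < cmod z")
      case True
      then show ?thesis using outer[of z] z by (simp add: d_def)
    next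
      case False
      then have "cmod (g w) \<le> cmod (g z)" by (intro w) simp
      then show ?thesis using gw unfolding d_def by linarith
    qed
    moreover have "d > 0" using \<epsilon> M gw by (simp add: d_def)
    ultimately show ?thesis unfolding bounded_away_from_0_def by blast
  qed
  from multiplier_image_eq_B[OF g_mult(1) this] have gB: "mult_op g ` B = B" .
  have "mult_op \<psi> ` B = mult_op (poly q) ` (mult_op g ` B)"
    unfolding image_image using g_mult(2) by (intro image_cong) simp_all
  then have img: "mult_op \<psi> ` B = mult_op (poly q) ` B" by (simp only: gB)
  from poly_image[OF q] obtain F where inj: "inj_on (mult_op (poly q)) B"
    and cl: "closedin mtopology (mult_op (poly q) ` B)"
    and F: "finite F" "F \<subseteq> B" "B \<subseteq> cfun.span (mult_op (poly q) ` B \<union> F)" by blast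
  have ker: "{f \<in> B. mult_op \<psi> f = 0} = {0}"
  proof (intro set_eqI iffI)
    fix f assume "f \<in> {f \<in> B. mult_op \<psi> f = 0}"
    then have f: "f \<in> B" "mult_op (poly q) (mult_op g f) = 0" using g_mult(2) by auto
    have zero: "mult_op \<phi> 0 = 0" for \<phi> by (simp add: mult_op_def zero_fun_def)
    have "mult_op g f \<in> B" using f g_mult(1) by (simp add: multiplier_def)
    then have "mult_op g f = 0" using inj_onD[OF inj, of "mult_op g f" 0] f B_0 zero by simp
    then have "mult_op g f = mult_op g 0" by (simp only: zero)
    then have "f = 0"
      by (rule mult_op_cancel[OF B_hol_disk[OF f(1)] B_hol_disk[OF B_0], rotated]) (rule g0)
    then show "f \<in> {0}" by simp
  next
    fix f :: "complex \<Rightarrow> complex" assume "f \<in> {0}"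
    then have "f = 0" by blast
    moreover have "mult_op \<psi> 0 = 0" by (simp add: mult_op_def zero_fun_def)
    ultimately show "f \<in> {f \<in> B. mult_op \<psi> f = 0}" using B_0 by simp
  qed
  show ?thesis
    unfolding fredholm_def
  proof (intro conjI)
    show "bounded_operator (mult_op \<psi>)" by (rule multiplier_bounded_operator[OF \<psi>])
    show "\<exists>F. finite F \<and> cfun.span F = {f \<in> B. mult_op \<psi> f = 0}"
      unfolding ker by (intro exI[of _ "{}"]) simp
    show "closedin mtopology (mult_op \<psi> ` B)" unfolding img by (rule cl)
    have "cfun.span (mult_op \<psi> ` B \<union> F) \<subseteq> B"
      using F multiplier_image_subset[OF \<psi>] by (intro cfun.span_minimal subspace_B) blast
    then show "\<exists>F. finite F \<and> cfun.span (mult_op \<psi> ` B \<union> F) = B"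
      using F by (intro exI[of _ F]) (simp only: img, blast)
  qed
qed

section \<open>Necessity\<close>

text \<open>The functions that multiplication by \<open>\<phi>\<close> sends into \<open>W\<close>
  form a closed set, so it suffices to test the dense polynomials.\<close>

lemma mult_op_closed_by_density:
  assumes "closedin mtopology W" and \<phi>: "multiplier B \<phi>"
    and "\<And>p. mult_op \<phi> (on_disk (poly p)) \<in> W" and "f \<in> B"
  shows "mult_op \<phi> f \<in> W"
proof -
  have "mtopology closure_of (range (\<lambda>p. on_disk (poly p))) \<subseteq> {f\<in>B. mult_op \<phi> f \<in> W}"
  proof (rule closure_of_minimal)
    show "closedin mtopology {f\<in>B. mult_op \<phi> f \<in> W}"
      by (rule closedin_vimage_bounded_operator[OF multiplier_bounded_operator[OF \<phi>] assms(1)])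
    show "range (\<lambda>p. on_disk (poly p)) \<subseteq> {f\<in>B. mult_op \<phi> f \<in> W}"
      using assms(3) poly_in_B by blast
  qed
  then show ?thesis using polynomials_dense assms(4) by blast
qed

text \<open>Boundary-extension type is the case \<open>cmod \<zeta> = 1\<close>; outside the closed disk \<open>z - \<zeta>\<close> is an invertible
  multiplier.\<close>

lemma power_in_closure:
  assumes n: "boundary_extension_type n" and \<zeta>: "1 \<le> cmod \<zeta>"
  shows "on_disk (\<lambda>z. (z - \<zeta>) ^ n) \<in> mtopology closure_of (mult_op (\<lambda>z. (z - \<zeta>) ^ (n + 1)) ` B)"
proof (cases "cmod \<zeta> = 1")
  case True
  then show ?thesis using n by (simp add: boundary_extension_type_def)
next
  case False
  have eq: "(\<lambda>z. (z - \<zeta>) ^ k) = poly ([:- \<zeta>, 1:] ^ k)" for k by auto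
  have "bounded_away_from_0 (poly [:- \<zeta>, 1:])"
    unfolding bounded_away_from_0_def
  proof (intro exI conjI ballI)
    show "cmod \<zeta> - 1 > 0" using False \<zeta> by simp
    show "cmod (poly [:- \<zeta>, 1:] z) > cmod \<zeta> - 1" if "z \<in> ball 0 1" for z
      using that norm_triangle_ineq2[of \<zeta> z] by (simp add: norm_minus_commute)
  qed
  from multiplier_image_eq_B[OF multiplier_poly this] poly_in_B
  have "on_disk (poly 1) \<in> mult_op (poly [:- \<zeta>, 1:]) ` B" by blast
  then obtain h where h: "h \<in> B" "on_disk (poly 1) = mult_op (poly [:- \<zeta>, 1:]) h" by (rule imageE)
  have "on_disk (poly ([:- \<zeta>, 1:] ^ n)) = mult_op (poly ([:- \<zeta>, 1:] ^ n)) (on_disk (poly 1))"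
    by (simp only: mult_op_poly_on_disk mult_1_right)
  also have "\<dots> = mult_op (poly ([:- \<zeta>, 1:] ^ (n + 1))) h"
    unfolding h(2) by (simp only: power_add power_one_right mult_op_poly_mult)
  finally have "on_disk (\<lambda>z. (z - \<zeta>) ^ n) \<in> mult_op (\<lambda>z. (z - \<zeta>) ^ (n + 1)) ` B"
    unfolding eq using h(1) by (rule image_eqI)
  moreover have "mult_op (\<lambda>z. (z - \<zeta>) ^ (n + 1)) ` B \<subseteq> B"
    unfolding eq by (rule multiplier_image_subset[OF multiplier_poly])
  ultimately show ?thesis
    using closure_of_subset[of _ mtopology] by (metis subsetD topspace_mtopology)
qed

lemma image_poly_module:
  assumes "f \<in> mult_op g ` B"
  shows "mult_op (poly p) f \<in> mult_op g ` B"
proof -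
  obtain h where h: "h \<in> B" "f = mult_op g h" using assms by blast
  have "mult_op (poly p) f = mult_op g (mult_op (poly p) h)"
    by (simp add: h mult_op_def mult.left_commute)
  then show ?thesis using mult_op_poly_in_B[OF h(1)] by (rule image_eqI)
qed

text \<open>For \<open>a\<close> in the disk, \<open>g\<close> has no zero at \<open>a\<close>, so
  the preimage under \<open>g\<close> vanishes there and one factor can be divided out. Otherwise
  the \<open>f\<close> with \<open>r f\<close> in \<open>g B\<close> form a closed set containing
  every multiple of \<open>(z - a) ^ (n + 1)\<close>, and the closure of these multiples contains
  \<open>(z - a) ^ n\<close>.\<close>

lemma reduce_linear_power:
  assumes n: "boundary_extension_type n" and g: "multiplier B g" "\<And>z. z \<in> ball 0 1 \<Longrightarrow> g z \<noteq> 0"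
    and W: "closedin mtopology (mult_op g ` B)"
    and mem: "on_disk (poly (r * [:- a, 1:] ^ Suc n)) \<in> mult_op g ` B"
  shows "on_disk (poly (r * [:- a, 1:] ^ n)) \<in> mult_op g ` B"
proof (cases "cmod a < 1")
  case True
  let ?l = "[:- a, 1:]"
  obtain h where h: "h \<in> B" "on_disk (poly (r * ?l ^ Suc n)) = mult_op g h" using mem by blast
  have "g a * h a = 0" using fun_cong[OF h(2), of a] True by (simp add: mult_op_def on_disk_def)
  then have "h a = 0" using g(2)[of a] True by simp
  then obtain u where u: "u \<in> B" "h = mult_op (poly ?l) u" using divide_zero[OF h(1), of a] True by auto
  have "on_disk (poly (r * ?l ^ n)) = mult_op g u"
  proof (rule hol_disk_eqI[where Z = "{a}"])
    show "on_disk (poly (r * ?l ^ n)) \<in> hol_disk" by (rule B_hol_disk[OF poly_in_B])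
    have "mult_op g u \<in> B" using g(1) u(1) by (simp add: multiplier_def)
    then show "mult_op g u \<in> hol_disk" by (rule B_hol_disk)
    fix z assume z: "z \<in> ball 0 1 - {a}"
    have pl: "poly (r * ?l ^ k) z = poly r z * (z - a) ^ k" for k by simp
    have "poly r z * (z - a) ^ Suc n = g z * h z"
      using fun_cong[OF h(2), of z] z unfolding mult_op_def on_disk_def pl by simp
    moreover have "h z = (z - a) * u z" by (simp add: u(2) mult_op_def)
    ultimately have "(z - a) * (poly r z * (z - a) ^ n) = (z - a) * (g z * u z)"
      by (simp only: power_Suc mult_ac)
    then show "on_disk (poly (r * ?l ^ n)) z = mult_op g u z"
      using z unfolding on_disk_def mult_op_def pl by simp
  qed simp
  then show ?thesis using u(1) by (rule image_eqI)
next
  case False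
  let ?l = "[:- a, 1:]"
  have eq: "(\<lambda>z. (z - a) ^ k) = poly (?l ^ k)" for k by auto
  have sub: "mult_op (poly (?l ^ (n + 1))) ` B \<subseteq> {f\<in>B. mult_op (poly r) f \<in> mult_op g ` B}"
  proof
    fix f assume "f \<in> mult_op (poly (?l ^ (n + 1))) ` B"
    then obtain b where b: "b \<in> B" "f = mult_op (poly (?l ^ (n + 1))) b" by (rule imageE)
    have "mult_op (poly (r * ?l ^ Suc n)) b \<in> mult_op g ` B"
    \<comment> \<open>The hypothesis gives membership for a single function. Polynomial multiples
      follow by commuting the factors, and all multiples from \<open>B\<close> by density.\<close>
    proof (rule mult_op_closed_by_density[OF W multiplier_poly _ b(1)])
      fix p
      have "mult_op (poly (r * ?l ^ Suc n)) (on_disk (poly p))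
          = mult_op (poly p) (on_disk (poly (r * ?l ^ Suc n)))"
        by (simp only: mult_op_poly_on_disk mult.commute)
      also have "\<dots> \<in> mult_op g ` B" by (rule image_poly_module[OF mem])
      finally show "mult_op (poly (r * ?l ^ Suc n)) (on_disk (poly p)) \<in> mult_op g ` B" .
    qed
    then have "mult_op (poly r) f \<in> mult_op g ` B"
      unfolding b(2) by (simp only: mult_op_poly_mult Suc_eq_plus1)
    moreover have "f \<in> B" unfolding b(2) by (rule mult_op_poly_in_B[OF b(1)])
    ultimately show "f \<in> {f\<in>B. mult_op (poly r) f \<in> mult_op g ` B}" by blast
  qed
  have "on_disk (poly (?l ^ n)) \<in> mtopology closure_of (mult_op (poly (?l ^ (n + 1))) ` B)"
    using power_in_closure[OF n, of a] False unfolding eq by simp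
  also have "\<dots> \<subseteq> {f\<in>B. mult_op (poly r) f \<in> mult_op g ` B}"
    by (rule closure_of_minimal[OF sub closedin_vimage_bounded_operator[OF
            multiplier_bounded_operator[OF multiplier_poly] W]])
  finally show ?thesis by (simp add: mult_op_poly_on_disk)
qed

text \<open>Induction on the degree, lowering the exponent of one linear factor at a time. The
  cofactor \<open>r\<close> is arbitrary in the induction: it first carries the untreated
  \<open>s ^ Suc n\<close>, then the already lowered power of the linear factor.\<close>

lemma reduce_power:
  assumes n: "boundary_extension_type n" and g: "multiplier B g" "\<And>z. z \<in> ball 0 1 \<Longrightarrow> g z \<noteq> 0"
    and W: "closedin mtopology (mult_op g ` B)" and "p \<noteq> 0"
    and mem: "on_disk (poly (r * p ^ Suc n)) \<in> mult_op g ` B"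
  shows "on_disk (poly (r * p ^ n)) \<in> mult_op g ` B"
  using assms(5,6)
proof (induction "degree p" arbitrary: p r)
  case 0
  then obtain c where p: "p = [:c:]" by (metis degree_eq_zeroE)
  with \<open>p \<noteq> 0\<close> have c: "c \<noteq> 0" by simp
  have "mult_op (poly [:1 / c:]) (on_disk (poly (r * p ^ Suc n))) = on_disk (poly (r * p ^ n))"
    unfolding mult_op_poly_on_disk using c by (simp add: p)
  then show ?case using image_poly_module[OF 0(3), of "[:1 / c:]"] by (simp only:)
next
  case (Suc d)
  then obtain a where "poly p a = 0" using alg_closed_imp_poly_has_root[of p] by auto
  then obtain s where p: "p = [:- a, 1:] * s" by (metis dvdE poly_eq_0_iff_dvd)
  have s: "s \<noteq> 0" using Suc.prems p by auto
  then have "degree p = degree [:- a, 1:] + degree s"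
    unfolding p by (intro degree_mult_eq) simp_all
  then have d: "d = degree s" using Suc.hyps(2) by simp
  have "r * p ^ Suc n = (r * s ^ Suc n) * [:- a, 1:] ^ Suc n"
    unfolding p power_mult_distrib by (simp only: mult_ac)
  with Suc.prems have "on_disk (poly ((r * s ^ Suc n) * [:- a, 1:] ^ Suc n)) \<in> mult_op g ` B"
    by (simp only:)
  from reduce_linear_power[OF n g W this]
  have "on_disk (poly ((r * [:- a, 1:] ^ n) * s ^ Suc n)) \<in> mult_op g ` B" by (simp only: mult_ac)
  from Suc.hyps(1)[OF d s this] show ?case
    unfolding p power_mult_distrib by (simp only: mult_ac)
qed

lemma power_in_image:
  assumes n: "boundary_extension_type n" and g: "multiplier B g" "\<And>z. z \<in> ball 0 1 \<Longrightarrow> g z \<noteq> 0"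
    and W: "closedin mtopology (mult_op g ` B)" and p: "p \<noteq> 0"
    and mem: "on_disk (poly (p ^ (n + k))) \<in> mult_op g ` B"
  shows "on_disk (poly (p ^ n)) \<in> mult_op g ` B"
  using mem
proof (induction k)
  case (Suc k)
  \<comment> \<open>The surplus \<open>p ^ k\<close> acts as cofactor, so that exactly
    \<open>Suc n\<close> copies of \<open>p\<close> are left to reduce.\<close>
  then have "on_disk (poly (p ^ k * p ^ Suc n)) \<in> mult_op g ` B"
    by (simp only: power_add[symmetric] add_Suc_right add.commute)
  from reduce_power[OF n g W p this] have "on_disk (poly (p ^ (n + k))) \<in> mult_op g ` B"
    by (simp only: power_add[symmetric] add.commute)
  then show ?case by (rule Suc.IH)
qed simp

section \<open>A uniform codimension bound and the invertibility of \<open>g\<close>\<close>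

text \<open>Division with remainder by \<open>p\<close> writes every polynomial as an element of
  \<open>g B\<close> plus a remainder of lower degree. The span is closed, being a
  finite-dimensional extension of a closed subspace, so density gives all of \<open>B\<close>. The
  number of generators depends only on \<open>degree p\<close>.\<close>

lemma B_eq_span_low_degree:
  assumes g: "multiplier B g" and W: "closedin mtopology (mult_op g ` B)"
    and p: "p \<noteq> 0" "on_disk (poly p) \<in> mult_op g ` B"
  shows "B \<subseteq> cfun.span (mult_op g ` B \<union> (\<lambda>i. on_disk (poly (monom 1 i))) ` {..<degree p})"
    (is "_ \<subseteq> cfun.span (?W \<union> ?F)")
proof -
  have cl: "closedin mtopology (cfun.span (?W \<union> ?F))"
    using poly_in_B by (intro closedin_span_Un_finite W subspace_image_multiplier g) auto
  have "on_disk (poly r) \<in> cfun.span (?W \<union> ?F)" for r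
  proof -
    have "on_disk (poly r) = on_disk (poly (r div p * p)) + on_disk (poly (r mod p))"
    proof -
      have "poly r z = poly (r div p) z * poly p z + poly (r mod p) z" for z
        by (simp only: poly_mult[symmetric] poly_add[symmetric] div_mult_mod_eq)
      then show ?thesis by (simp add: on_disk_def fun_eq_iff)
    qed
    moreover have "on_disk (poly (r div p * p)) \<in> cfun.span (?W \<union> ?F)"
      using image_poly_module[OF p(2), of "r div p"]
      by (intro cfun.span_base) (simp add: mult_op_poly_on_disk)
    moreover have "on_disk (poly (r mod p)) \<in> cfun.span (?W \<union> ?F)"
    proof -
      let ?s = "r mod p"
      have "on_disk (poly ?s) = (\<Sum>i\<le>degree ?s. cscale (coeff ?s i) (on_disk (poly (monom 1 i))))"
        by (simp add: fun_eq_iff sum_fun_apply on_disk_def cscale_def poly_monom poly_altdef[of ?s])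
      also have "\<dots> \<in> cfun.span (?W \<union> ?F)"
      proof (rule cfun.span_sum)
        fix i assume i: "i \<in> {..degree ?s}"
        show "cscale (coeff ?s i) (on_disk (poly (monom 1 i))) \<in> cfun.span (?W \<union> ?F)"
        \<comment> \<open>The zero remainder has degree \<open>0\<close>, so the index
          \<open>0\<close> occurs even when \<open>degree p = 0\<close>; its coefficient is then
          \<open>0\<close>.\<close>
        proof (cases "?s = 0")
          case True
          have "cscale 0 f = 0" for f by (simp add: cscale_def zero_fun_def)
          then show ?thesis unfolding True coeff_0 by (simp only: cfun.span_zero)
        next
          case False
          then have "i < degree p" using i degree_mod_less'[OF p(1), of r] by simp
          then show ?thesis
            by (intro cfun.span_scale cfun.span_base UnI2 imageI) simp
        qed
      qed
      finally show ?thesis .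
    qed
    ultimately show ?thesis by (simp only: cfun.span_add)
  qed
  then have "mtopology closure_of (range (\<lambda>p. on_disk (poly p))) \<subseteq> cfun.span (?W \<union> ?F)"
    by (intro closure_of_minimal cl image_subsetI)
  then show ?thesis by (simp only: polynomials_dense)
qed

text \<open>The lowest nonvanishing term of \<open>C\<close> is isolated after cancelling the powers of \<open>g\<close> below it, which
  is possible because its exponent is less than \<open>k\<close>.\<close>

lemma one_in_image:
  assumes g: "multiplier B g" "\<And>z. z \<in> ball 0 1 \<Longrightarrow> g z \<noteq> 0"
    and "C \<noteq> 0" "degree C < k" "b \<in> B" "on_disk (\<lambda>z. poly C (g z)) = mult_op (\<lambda>z. g z ^ k) b"
  shows "on_disk (poly 1) \<in> mult_op g ` B"
  using assms(3-6)
proof (induction C arbitrary: k)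
  case (pCons a C)
  then obtain m where k: "k = Suc m" by (metis less_imp_Suc_add)
  have eq: "a + g z * poly C (g z) = g z * (g z ^ m * b z)" if "z \<in> ball 0 1" for z
    using fun_cong[OF pCons.prems(4), of z] that by (simp add: on_disk_def mult_op_def k mult.assoc)
  have gm: "mult_op (\<lambda>z. g z ^ m) b \<in> B"
    using multiplier_power[OF g(1), of m] pCons.prems(3) by (simp add: multiplier_def)
  have pC: "on_disk (\<lambda>z. poly D (g z)) \<in> B" for D
  proof (induction D)
    case 0
    have "on_disk (\<lambda>z. poly 0 (g z)) = on_disk (poly 0)" by (simp add: on_disk_def fun_eq_iff)
    then show ?case using poly_in_B[of 0] by (simp only:)
  next
    case (pCons c D)
    have "on_disk (\<lambda>z. poly (pCons c D) (g z)) =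
        on_disk (poly [:c:]) + mult_op g (on_disk (\<lambda>z. poly D (g z)))"
      by (auto simp: on_disk_def mult_op_def)
    moreover have "mult_op g (on_disk (\<lambda>z. poly D (g z))) \<in> B"
      using g(1) pCons.IH by (simp add: multiplier_def)
    ultimately show ?case using B_add[OF poly_in_B] by (simp only:)
  qed
  have bz: "b z = 0" if "z \<notin> ball 0 1" for z
    using B_hol_disk[OF pCons.prems(3)] that by (simp add: hol_disk_def)
  show ?case
  proof (cases "a = 0")
    case False
    define h where "h = cscale (1 / a) (mult_op (\<lambda>z. g z ^ m) b - on_disk (\<lambda>z. poly C (g z)))"
    have hB: "h \<in> B" unfolding h_def by (intro B_scale B_diff gm pC)
    have "on_disk (poly 1) = mult_op g h"
    proof
      fix z
      show "on_disk (poly 1) z = mult_op g h z"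
      proof (cases "z \<in> ball 0 1")
        case True
        let ?y = "g z ^ m * b z - poly C (g z)"
        have y: "a = g z * ?y"
          unfolding right_diff_distrib eq_diff_eq by (rule eq[OF True])
        have "g z * (1 / a * ?y) = (g z * ?y) / a" by (simp only: times_divide_eq_right mult_1 times_divide_eq_left)
        also have "\<dots> = 1" by (simp only: y[symmetric] divide_self[OF False])
        finally have "mult_op g h z = 1"
          using True by (simp only: h_def on_disk_def mult_op_def cscale_def minus_apply if_True)
        then show ?thesis using True by (simp only: on_disk_def poly_1 if_True)
      qed (use bz in \<open>simp add: h_def on_disk_def mult_op_def cscale_def\<close>)
    qed
    then show ?thesis using hB by (rule image_eqI)
  \<comment> \<open>With no constant term, one factor \<open>g\<close> cancels from both sides;
    \<open>degree C\<close> and \<open>k\<close> drop together, so the strict inequality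
    survives.\<close>
  next
    case True
    with pCons.prems(1) have C: "C \<noteq> 0" by simp
    with pCons.prems(2) have "degree C < m" by (simp add: k)
    moreover have "on_disk (\<lambda>z. poly C (g z)) = mult_op (\<lambda>z. g z ^ m) b"
    proof
      fix z
      show "on_disk (\<lambda>z. poly C (g z)) z = mult_op (\<lambda>z. g z ^ m) b z"
      proof (cases "z \<in> ball 0 1")
        case t: True
        have "g z * poly C (g z) = g z * (g z ^ m * b z)" using eq[OF t] True by simp
        with g(2)[OF t] have "poly C (g z) = g z ^ m * b z" by simp
        with t show ?thesis by (simp add: on_disk_def mult_op_def)
      qed (use bz in \<open>simp add: on_disk_def mult_op_def\<close>)
    qed
    ultimately show ?thesis by (intro pCons.IH[OF C _ pCons.prems(3)])
  qed
qed simp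

text \<open>The codimensions of all the ranges \<open>g ^ k B\<close> are bounded by one number
  \<open>d\<close>. A chain of powers of \<open>g\<close> longer than \<open>d\<close> is then
  dependent modulo \<open>g ^ (d + 1) B\<close>, which forces \<open>g\<close> to be onto.\<close>

theorem bounded_away_if_image_contains_poly:
  assumes g: "multiplier B g" "\<And>z. z \<in> ball 0 1 \<Longrightarrow> g z \<noteq> 0"
    and cl: "closedin mtopology (mult_op g ` B)"
    and p: "p \<noteq> 0" "on_disk (poly p) \<in> mult_op g ` B"
  shows "bounded_away_from_0 g"
proof -
  obtain n where n: "boundary_extension_type n" using boundary_extension by blast
  let ?W = "\<lambda>k. mult_op (\<lambda>z. g z ^ k) ` B"
  have gk: "multiplier B (\<lambda>z. g z ^ k)" "\<And>z. z \<in> ball 0 1 \<Longrightarrow> g z ^ k \<noteq> 0" for k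
    using multiplier_power[OF g(1)] g(2) by auto
  have inj: "inj_on (mult_op g) B"
    by (rule inj_onI) (rule mult_op_cancel[where \<phi> = g, OF B_hol_disk B_hol_disk g(2)])
  have W_Suc: "?W (Suc k) = mult_op g ` ?W k" for k
    by (simp add: image_image mult_op_mult_op)
  \<comment> \<open>Each further power applies \<open>mult_op g\<close> once more, an injective
    operator with closed range, which preserves closed sets.\<close>
  have clW: "closedin mtopology (?W k)" for k
  proof (induction k)
    case 0
    have "?W 0 = B" by (auto simp: mult_op_def)
    then show ?case using closedin_topspace[of mtopology] by (simp only: topspace_mtopology)
  next
    case (Suc k)
    show ?case unfolding W_Suc
      by (rule closedin_image_bounded_operator[OF mcomplete_B multiplier_bounded_operator[OF g(1)] inj cl Suc])
  qed
  have pB: "mult_op (poly p) f \<in> mult_op g ` B" if "f \<in> B" for f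
  proof (rule mult_op_closed_by_density[OF cl multiplier_poly _ that])
    fix r
    show "mult_op (poly p) (on_disk (poly r)) \<in> mult_op g ` B"
      using image_poly_module[OF p(2), of r] by (simp only: mult_op_poly_on_disk mult.commute)
  qed
  have pkB: "mult_op (poly (p ^ k)) f \<in> ?W k" if "f \<in> B" for f k
  proof (induction k)
    case 0
    have "mult_op (poly (p ^ 0)) f = mult_op (\<lambda>z. g z ^ 0) f" by (simp add: mult_op_def)
    then show ?case using that by (rule image_eqI)
  next
    case (Suc k)
    then obtain h where h: "h \<in> B" "mult_op (poly (p ^ k)) f = mult_op (\<lambda>z. g z ^ k) h" by blast
    obtain u where u: "u \<in> B" "mult_op (poly p) h = mult_op g u" using pB[OF h(1)] by blast
    have "mult_op (poly (p ^ Suc k)) f = mult_op (poly p) (mult_op (\<lambda>z. g z ^ k) h)"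
      by (simp only: power_Suc mult_op_poly_mult h(2))
    also have "\<dots> = mult_op (\<lambda>z. g z ^ k) (mult_op (poly p) h)"
      by (simp add: mult_op_def mult.left_commute)
    also have "\<dots> = mult_op (\<lambda>z. g z ^ Suc k) u"
      by (simp add: u(2) mult_op_mult_op mult.commute)
    finally show ?case using u(1) by (rule image_eqI)
  qed
  have pn: "on_disk (poly (p ^ n)) \<in> ?W k" for k
  proof (rule power_in_image[OF n gk clW p(1)])
    show "on_disk (poly (p ^ (n + k))) \<in> ?W k"
      using pkB[OF poly_in_B, of k "p ^ n"]
      by (simp only: mult_op_poly_on_disk power_add[symmetric] add.commute)
  qed
  define d where "d = degree (p ^ n)"
  define F where "F = (\<lambda>i. on_disk (poly (monom 1 i))) ` {..<d}"
  have "p ^ n \<noteq> 0" using p(1) by simp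
  from B_eq_span_low_degree[OF gk(1) clW this pn]
  have span: "B \<subseteq> cfun.span (?W (Suc d) \<union> F)" by (simp only: F_def d_def)
  have x: "mult_op (\<lambda>z. g z ^ i) (on_disk (poly 1)) \<in> B" for i
    using gk(1) poly_in_B by (simp add: multiplier_def)
  have "card F \<le> card {..<d}" unfolding F_def by (rule card_image_le) simp
  \<comment> \<open>The exponents \<open>0\<close> to \<open>d\<close> give \<open>d + 1\<close>
    vectors against at most \<open>d\<close> generators.\<close>
  then have card: "card F < card {..d}" by simp
  have finF: "finite F" by (simp add: F_def)
  have "\<exists>c. (\<exists>i\<in>{..d}. c i \<noteq> 0) \<and>
    (\<Sum>i\<le>d. cscale (c i) (mult_op (\<lambda>z. g z ^ i) (on_disk (poly 1)))) \<in> ?W (Suc d)"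
    by (rule cfun.nontrivial_combination_in_subspace[OF finF subspace_image_multiplier[OF gk(1)]
          finite_atMost card subsetD[OF span x]])
  then obtain c where c: "\<exists>i\<in>{..d}. c i \<noteq> 0"
    "(\<Sum>i\<le>d. cscale (c i) (mult_op (\<lambda>z. g z ^ i) (on_disk (poly 1)))) \<in> ?W (Suc d)" by (elim exE conjE)
  define C where "C = (\<Sum>i\<le>d. monom (c i) i)"
  have coeff: "coeff C i = (if i \<le> d then c i else 0)" for i
    by (simp add: C_def coeff_sum)
  have C: "C \<noteq> 0" using c(1) coeff by (metis atMost_iff coeff_0)
  have deg: "degree C < Suc d" using degree_le[of d C] coeff by (simp add: less_Suc_eq_le)
  have "(\<Sum>i\<le>d. cscale (c i) (mult_op (\<lambda>z. g z ^ i) (on_disk (poly 1)))) =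
      on_disk (\<lambda>z. poly C (g z))"
    by (simp add: fun_eq_iff sum_fun_apply on_disk_def cscale_def mult_op_def C_def poly_monom_sum)
  with c(2) have "on_disk (\<lambda>z. poly C (g z)) \<in> ?W (Suc d)" by (simp only:)
  then obtain b where b: "on_disk (\<lambda>z. poly C (g z)) = mult_op (\<lambda>z. g z ^ Suc d) b" "b \<in> B"
    by (rule imageE)
  have one: "on_disk (poly 1) \<in> mult_op g ` B"
    by (rule one_in_image[OF g C deg b(2,1)])
  have gB: "f \<in> mult_op g ` B" if f: "f \<in> B" for f
  proof -
    have "mult_op (poly 1) f \<in> mult_op g ` B"
    proof (rule mult_op_closed_by_density[OF cl multiplier_poly _ f])
      fix r
      show "mult_op (poly 1) (on_disk (poly r)) \<in> mult_op g ` B"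
        using image_poly_module[OF one, of r] by (simp only: mult_op_poly_on_disk mult.commute)
    qed
    moreover have "mult_op (poly 1) f = f" by (simp add: mult_op_def)
    ultimately show ?thesis by (simp only:)
  qed
  have "multiplier B (\<lambda>z. 1 / g z)"
    unfolding multiplier_def
  proof (intro conjI ballI)
    show "(\<lambda>z. 1 / g z) holomorphic_on ball 0 1"
      using g by (intro holomorphic_intros) (auto simp: multiplier_def)
    fix f assume "f \<in> B"
    from gB[OF this] obtain h where h: "h \<in> B" "f = mult_op g h" by blast
    have "mult_op (\<lambda>z. 1 / g z) f = mult_op (\<lambda>_. 1) h"
      unfolding h(2) mult_op_mult_op using g(2) by (intro mult_op_cong B_hol_disk h(1)) simp
    then show "mult_op (\<lambda>z. 1 / g z) f \<in> B" using h(1) by (simp add: mult_op_def)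
  qed
  from multiplier_bounded[OF this] obtain K where K: "\<And>z. z \<in> ball 0 1 \<Longrightarrow> cmod (1 / g z) \<le> K" by blast
  \<comment> \<open>The added \<open>1\<close> makes \<open>L\<close> positive and the bound on
    \<open>1 / g\<close> strict.\<close>
  define L where "L = max K 0 + 1"
  have "cmod (g z) > 1 / L" if z: "z \<in> ball 0 1" for z
  proof -
    have "1 / cmod (g z) < L" using K[OF z] by (simp add: L_def norm_divide)
    moreover have "L > 0" "cmod (g z) > 0" using g(2)[OF z] by (simp_all add: L_def)
    ultimately show ?thesis by (simp add: field_simps)
  qed
  moreover have "1 / L > 0" by (simp add: L_def)
  ultimately show ?thesis unfolding bounded_away_from_0_def by blast
qed

text \<open>Finite codimension puts a nonzero polynomial \<open>p\<close> into the range. Its roots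
  include the zeros of \<open>\<psi>\<close>, which are thus finite in number and split off as
  \<open>q\<close>; the polynomial \<open>p\<close> lies in the range of \<open>g\<close> too. The
  lower bound for \<open>g\<close> passes to \<open>\<psi>\<close> on an annulus beyond the roots of
  \<open>q\<close>.\<close>

lemma bounded_away_if_fredholm:
  assumes \<psi>: "multiplier B \<psi>" and fred: "fredholm (mult_op \<psi>)"
  shows "bounded_away_from_0_near_boundary \<psi>"
proof -
  have cl: "closedin mtopology (mult_op \<psi> ` B)"
    and "\<exists>F. finite F \<and> cfun.span (mult_op \<psi> ` B \<union> F) = B"
    using fred by (auto simp: fredholm_def)
  then obtain F where F: "finite F" "cfun.span (mult_op \<psi> ` B \<union> F) = B" by blast
  \<comment> \<open>One more monomial than there are generators in \<open>F\<close>, so some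
    nontrivial combination lies in the range.\<close>
  have "card F < card {..card F}" by simp
  then have "\<exists>c. (\<exists>i\<in>{..card F}. c i \<noteq> 0) \<and>
    (\<Sum>i\<le>card F. cscale (c i) (on_disk (poly (monom 1 i)))) \<in> mult_op \<psi> ` B"
    by (intro cfun.nontrivial_combination_in_subspace[OF F(1) subspace_image_multiplier[OF \<psi>]])
      (simp_all only: F(2) poly_in_B finite_atMost)
  then obtain c where c: "\<exists>i\<in>{..card F}. c i \<noteq> 0"
    "(\<Sum>i\<le>card F. cscale (c i) (on_disk (poly (monom 1 i)))) \<in> mult_op \<psi> ` B" by (elim exE conjE)
  define p where "p = (\<Sum>i\<le>card F. monom (c i) i)"
  have coeff: "coeff p i = (if i \<le> card F then c i else 0)" for i
    by (simp add: p_def coeff_sum)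
  have p: "p \<noteq> 0" using c(1) coeff by (metis atMost_iff coeff_0)
  have "(\<Sum>i\<le>card F. cscale (c i) (on_disk (poly (monom 1 i)))) = on_disk (poly p)"
    by (simp add: fun_eq_iff sum_fun_apply on_disk_def cscale_def p_def poly_monom_sum poly_monom)
  with c(2) obtain h where h: "h \<in> B" "on_disk (poly p) = mult_op \<psi> h" by auto
  have "{z \<in> ball 0 1. \<psi> z = 0} \<subseteq> {z. poly p z = 0}"
  proof
    fix z assume "z \<in> {z \<in> ball 0 1. \<psi> z = 0}"
    with fun_cong[OF h(2), of z] show "z \<in> {z. poly p z = 0}" by (simp add: on_disk_def mult_op_def)
  qed
  then have "finite {z \<in> ball 0 1. \<psi> z = 0}" using poly_roots_finite[OF p] by (rule finite_subset)
  moreover have "\<psi> holomorphic_on ball 0 1" using \<psi> by (simp add: multiplier_def)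
  ultimately obtain q g where q: "{z. poly q z = 0} \<subseteq> ball 0 1" and g: "g holomorphic_on ball 0 1"
    and g0: "\<And>z. z \<in> ball 0 1 \<Longrightarrow> g z \<noteq> 0"
    and eq: "\<And>z. z \<in> ball 0 1 \<Longrightarrow> \<psi> z = poly q z * g z"
    using holomorphic_factor_finite_zeros[of "ball 0 1" \<psi>] by auto
  have g_mult: "multiplier B g" "\<And>f. f \<in> B \<Longrightarrow> mult_op \<psi> f = mult_op (poly q) (mult_op g f)"
    by (rule quotient_multiplier[OF \<psi> q g], simp_all add: eq)+
  \<comment> \<open>By injectivity of multiplication by \<open>q\<close>, the range of
    \<open>g\<close> is the preimage of the closed range of \<open>\<psi>\<close> under a bounded
    operator, hence closed.\<close>
  have "mult_op g ` B = {f\<in>B. mult_op (poly q) f \<in> mult_op \<psi> ` B}"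
  proof
    show "mult_op g ` B \<subseteq> {f\<in>B. mult_op (poly q) f \<in> mult_op \<psi> ` B}"
      using g_mult multiplier_image_subset[OF g_mult(1)] by (auto simp flip: g_mult(2))
    show "{f\<in>B. mult_op (poly q) f \<in> mult_op \<psi> ` B} \<subseteq> mult_op g ` B"
    proof
      fix f assume "f \<in> {f\<in>B. mult_op (poly q) f \<in> mult_op \<psi> ` B}"
      then obtain u where f: "f \<in> B" and u: "u \<in> B" "mult_op (poly q) f = mult_op \<psi> u" by blast
      have "inj_on (mult_op (poly q)) B" using poly_image[OF q] by blast
      moreover have "mult_op g u \<in> B" using g_mult(1) u(1) by (simp add: multiplier_def)
      ultimately have "f = mult_op g u" using f u g_mult(2)[OF u(1)] by (simp add: inj_on_def)
      then show "f \<in> mult_op g ` B" using u(1) by (rule image_eqI)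
    qed
  qed
  moreover have "closedin mtopology {f\<in>B. mult_op (poly q) f \<in> mult_op \<psi> ` B}"
    by (rule closedin_vimage_bounded_operator[OF multiplier_bounded_operator[OF multiplier_poly] cl])
  ultimately have clg: "closedin mtopology (mult_op g ` B)" by (simp only:)
  have "on_disk (poly p) = mult_op g (mult_op (poly q) h)"
    unfolding h(2) g_mult(2)[OF h(1)] by (simp add: mult_op_def mult.left_commute)
  then have "on_disk (poly p) \<in> mult_op g ` B" using mult_op_poly_in_B[OF h(1)] by (rule image_eqI)
  from bounded_away_if_image_contains_poly[OF g_mult(1) g0 clg p this]
  obtain e where e: "e > 0" "\<And>z. z \<in> ball 0 1 \<Longrightarrow> cmod (g z) > e"
    unfolding bounded_away_from_0_def by blast
  have "q \<noteq> 0"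
  proof
    assume "q = 0"
    then have "1 \<in> {z. poly q z = 0}" by simp
    with q have "(1::complex) \<in> ball 0 1" by blast
    then show False by simp
  qed
  then have fin: "finite (insert 0 (cmod ` {z. poly q z = 0}))" using poly_roots_finite by blast
  \<comment> \<open>The midpoint between the largest modulus of a root and \<open>1\<close>;
    inserting \<open>0\<close> covers a polynomial without roots.\<close>
  define s where "s = (1 + Max (insert 0 (cmod ` {z. poly q z = 0}))) / 2"
  have "Max (insert 0 (cmod ` {z. poly q z = 0})) < 1" using fin q by (subst Max_less_iff) auto
  moreover have "Max (insert 0 (cmod ` {z. poly q z = 0})) \<ge> 0" using fin by (intro Max_ge) auto
  ultimately have s: "0 < s" "s < 1" "Max (insert 0 (cmod ` {z. poly q z = 0})) < s"
    by (simp_all add: s_def)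
  \<comment> \<open>The annulus includes the unit circle so as to be compact; \<open>q\<close> has
    no zeros there either, so its modulus attains a positive minimum.\<close>
  define A where "A = cball (0::complex) 1 - ball 0 s"
  have q0: "poly q z \<noteq> 0" if "z \<in> A" for z
  proof
    assume "poly q z = 0"
    then have "cmod z \<le> Max (insert 0 (cmod ` {z. poly q z = 0}))" using fin by (intro Max_ge) auto
    with s that show False by (simp add: A_def)
  qed
  have "compact A" unfolding A_def by (intro compact_diff) auto
  moreover have "1 \<in> A" using s by (simp add: A_def)
  moreover have "continuous_on A (\<lambda>z. cmod (poly q z))" by (intro continuous_intros)
  ultimately obtain w where w: "w \<in> A" "\<And>z. z \<in> A \<Longrightarrow> cmod (poly q w) \<le> cmod (poly q z)"
    using continuous_attains_inf[of A "\<lambda>z. cmod (poly q z)"] by blast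
  have "cmod (\<psi> z) > cmod (poly q w) * e" if z: "s < cmod z" "cmod z < 1" for z
  proof -
    have "cmod (poly q w) * e \<le> cmod (poly q z) * e"
      using w(2)[of z] z e by (intro mult_right_mono) (simp_all add: A_def)
    also have "\<dots> < cmod (poly q z) * cmod (g z)"
      using q0[of z] e(2)[of z] z by (intro mult_strict_left_mono) (simp_all add: A_def)
    also have "\<dots> = cmod (\<psi> z)" using eq[of z] z by (simp add: norm_mult)
    finally show ?thesis .
  qed
  moreover have "cmod (poly q w) * e > 0" using q0[OF w(1)] e by simp
  ultimately show ?thesis unfolding bounded_away_from_0_near_boundary_def using s by blast
qed

end

theorem theorem3p1:
  fixes B :: "(complex \<Rightarrow> complex) set" and nm :: "(complex \<Rightarrow> complex) \<Rightarrow> real"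
    and \<psi> :: "complex \<Rightarrow> complex"
  assumes "admissible_space B nm" and "multiplier B \<psi>"
  shows "normed_function_space.fredholm B nm (mult_op \<psi>) \<longleftrightarrow> bounded_away_from_0_near_boundary \<psi>"
proof -
  interpret admissible_space B nm by fact
  show ?thesis
    using fredholm_if_bounded_away bounded_away_if_fredholm assms(2) by blast
qed

end
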